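(* Let $K$ be a number field and let $n \in \mathbf{N}$. Then $\mathrm{C}_n(K)$ is primitive if and only if $n$ divides $\widehat{\varkappa_K(n)}$.
   Context: $\mathbf{N} = \{1,2,\dots\}$; number fields are regarded as subfields of the algebraic closure $\bar{\mathbf{Q}}$ of $\mathbf{Q}$ in $\mathbf{C}$. $\mathbf{E}_n = \mathbf{Q}(\zeta_n)$ denotes the $n$th cyclotomic field, with $\zeta_n$ a primitive $n$th root of unity. Linear groups: a linear group over $K$ is a subgroup $G\le \mathrm{GL}(V)$, $V$ a finite-dimensional $K$-vector space. An irreducible linear group $G \le \mathrm{GL}(V)$ is imprimitive if there is a decomposition $V = U_1\oplus\dots\oplus U_r$ into a direct sum of proper subspaces permuted by $G$; otherwise the irreducible group $G$ is primitive. $\mathrm{C}_n$ is the cyclic group of order $n$, and $\mathrm{C}_n(K)$ denotes the irreducible linear group over $K$ that is isomorphic to $\mathrm{C}_n$; it exists and is unique up to similarity (similarity of $G\le\mathrm{GL}(V)$ and $H\le\mathrm{GL}(W)$ means that some $K$-isomorphism $V\to W$ conjugates $G$ to $H$). Invariant: $\varkappa_K(n) = \gcd\{ d \in \mathbf{N} : K\cap \mathbf{E}_n \subset \mathbf{E}_d\}$, a positive divisor of $n$. Supernatural numbers: a supernatural number is a formal product $\prod_p p^{n_p}$ over all primes $p$ with $n_p \in \mathbf{N}\cup\{0,\infty\}$; divisibility extends to these exponentwise. For $a \in \mathbf{N}$, $\widehat{a} = a\cdot\prod\{p \text{ prime} : p\nmid a\}$. Thus $n \mid \widehat a$ means that for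 every prime $p$, $\nu_p(n)\le \max(\nu_p(a),1)$. *)

theory Defs
  imports
    Complex_Main
    "HOL-Library.Extended_Nat"
    "HOL-Computational_Algebra.Primes"
    "HOL-Combinatorics.Permutations"
    "HOL-Algebra.Bij"
    "HOL-Algebra.Elementary_Groups"
    "HOL-Algebra.Embedded_Algebras"
    "HOL-Algebra.Generated_Fields"
    "Jordan_Normal_Form.VS_Connect"
begin

definition number_field :: "complex set \<Rightarrow> bool" where
  "number_field K \<longleftrightarrow> subfield K class_ring \<and> ring.finite_dimension class_ring \<rat> K"

abbreviation field_of :: "complex set \<Rightarrow> complex ring" where
  "field_of K \<equiv> class_ring\<lparr>carrier := K\<rparr>"

definition cyclotomic_field :: "nat \<Rightarrow> complex set" where
  "cyclotomic_field n = generate_field class_ring (\<rat> \<union> {cis (2 * pi / real n)})"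

definition kappa :: "complex set \<Rightarrow> nat \<Rightarrow> nat" where
  "kappa K n = Gcd {d. d \<ge> 1 \<and> K \<inter> cyclotomic_field n \<subseteq> cyclotomic_field d}"

text \<open>A supernatural number is given by its exponents; values at non-primes carry no meaning.\<close>

type_synonym supernatural = "nat \<Rightarrow> enat"

definition supernatural_of_nat :: "nat \<Rightarrow> supernatural" where
  "supernatural_of_nat a = (\<lambda>p. enat (multiplicity p a))"

definition supernatural_mult :: "supernatural \<Rightarrow> supernatural \<Rightarrow> supernatural" where
  "supernatural_mult a b = (\<lambda>p. a p + b p)"

definition supernatural_dvd :: "supernatural \<Rightarrow> supernatural \<Rightarrow> bool" where
  "supernatural_dvd a b \<longleftrightarrow> (\<forall>p. prime p \<longrightarrow> a p \<le> b p)"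

definition prod_primes :: "nat set \<Rightarrow> supernatural" where
  "prod_primes P = (\<lambda>p. if p \<in> P then 1 else 0)"

definition hat :: "nat \<Rightarrow> supernatural" where
  "hat a = supernatural_mult (supernatural_of_nat a) (prod_primes {p. prime p \<and> \<not> p dvd a})"

text \<open>Linear automorphisms are taken extensional outside the carrier, as in \<^const>\<open>AutoGroup\<close>.\<close>

definition GL :: "('a, 'f) ring_scheme \<Rightarrow> ('a, 'v, 'm) module_scheme \<Rightarrow> ('v \<Rightarrow> 'v) monoid" where
  "GL F V = BijGroup (carrier V) \<lparr>carrier := module_hom F V V \<inter> Bij (carrier V)\<rparr>"

definition linear_group ::
    "('a, 'f) ring_scheme \<Rightarrow> ('a, 'v, 'm) module_scheme \<Rightarrow> ('v \<Rightarrow> 'v) set \<Rightarrow> bool" where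
  "linear_group F V G \<longleftrightarrow>
     vectorspace F V \<and> vectorspace.fin_dim F V \<and> subgroup G (GL F V)"

definition irreducible_linear_group ::
    "('a, 'f) ring_scheme \<Rightarrow> ('a, 'v, 'm) module_scheme \<Rightarrow> ('v \<Rightarrow> 'v) set \<Rightarrow> bool" where
  "irreducible_linear_group F V G \<longleftrightarrow>
     linear_group F V G \<and> carrier V \<noteq> {\<zero>\<^bsub>V\<^esub>} \<and>
     (\<forall>W. VectorSpace.subspace F W V \<and> (\<forall>g\<in>G. g ` W \<subseteq> W) \<longrightarrow> W = {\<zero>\<^bsub>V\<^esub>} \<or> W = carrier V)"

definition direct_sum_decomposition ::
    "('a, 'f) ring_scheme \<Rightarrow> ('a, 'v, 'm) module_scheme \<Rightarrow> nat \<Rightarrow> (nat \<Rightarrow> 'v set) \<Rightarrow> bool" where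
  "direct_sum_decomposition F V r U \<longleftrightarrow>
     (\<forall>i<r. VectorSpace.subspace F (U i) V) \<and>
     (\<forall>v\<in>carrier V. \<exists>!u. u \<in> (\<Pi>\<^sub>E i\<in>{..<r}. U i) \<and> v = finsum V u {..<r})"

definition imprimitive_linear_group ::
    "('a, 'f) ring_scheme \<Rightarrow> ('a, 'v, 'm) module_scheme \<Rightarrow> ('v \<Rightarrow> 'v) set \<Rightarrow> bool" where
  "imprimitive_linear_group F V G \<longleftrightarrow>
     irreducible_linear_group F V G \<and>
     (\<exists>r U. direct_sum_decomposition F V r U \<and>
        (\<forall>i<r. U i \<noteq> carrier V) \<and>
        (\<forall>g\<in>G. \<exists>\<pi>. \<pi> permutes {..<r} \<and> (\<forall>i<r. g ` U i = U (\<pi> i))))"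

definition primitive_linear_group ::
    "('a, 'f) ring_scheme \<Rightarrow> ('a, 'v, 'm) module_scheme \<Rightarrow> ('v \<Rightarrow> 'v) set \<Rightarrow> bool" where
  "primitive_linear_group F V G \<longleftrightarrow>
     irreducible_linear_group F V G \<and> \<not> imprimitive_linear_group F V G"

text \<open>
  \<open>G\<close>, acting on \<open>V\<close>, is a copy of the irreducible linear group $C_n(F)$.  The latter is only
  defined up to similarity, so it is rendered as a predicate that holds for all its copies.
\<close>

definition irreducible_cyclic_linear_group ::
    "nat \<Rightarrow> ('a, 'f) ring_scheme \<Rightarrow> ('a, 'v, 'm) module_scheme \<Rightarrow> ('v \<Rightarrow> 'v) set \<Rightarrow> bool" where
  "irreducible_cyclic_linear_group n F V G \<longleftrightarrow>
     irreducible_linear_group F V G \<and> (GL F V)\<lparr>carrier := G\<rparr> \<cong> integer_mod_group n"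

end

theory Submission
  imports Defs
    "HOL-Combinatorics.Cycles"
    "HOL-Computational_Algebra.Fundamental_Theorem_Algebra"
    "HOL-Number_Theory.Cong"
begin

text \<open>
  Let \<open>g\<close> generate the group and let \<open>E\<^sub>n\<close> be the field of \<open>n\<close>-th roots of unity.  By irreducibility \<open>f(g) v\<close>
  corresponds to \<open>f(z)\<close> for an eigenvalue \<open>z\<close> of \<open>g\<close>.  So \<open>V\<close> may be taken to be the field \<open>K(z)\<close>, where
  \<open>z\<close> is a primitive \<open>n\<close>-th root of unity and \<open>g\<close> is multiplication by \<open>z\<close> (lemma \<open>coordinates_exist\<close>).

  The group is imprimitive if and only if, for some prime divisor \<open>p\<close> of \<open>n\<close>, every relation
  $\sum_j c_j z^j = 0$ over \<open>K\<close> splits into separate relations for the classes of exponents \<open>j\<close> modulo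
  \<open>p\<close>.  If relations split, then the \<open>p\<close> subspaces spanned by the powers of \<open>z\<close> with exponents in a given
  class are permuted cyclically by \<open>g\<close> and their sum is direct (\<open>decomposition_if_graded_relations\<close>).
  Conversely \<open>g\<close> moves a nonzero block along an orbit whose length is greater than \<open>1\<close> and divides \<open>n\<close>; any
  prime \<open>p\<close> dividing this length will do, since in a relation applied to a vector of the
  block the contributions to each block vanish separately (\<open>graded_relations_if_blocks\<close>).

  What remains is arithmetic: relations split at \<open>p\<close> if and only if \<open>p\<^sup>2\<close> divides \<open>n\<close> and \<open>K \<inter> E\<^sub>n\<close> is contained
  in the field of roots of unity of order \<open>n / p\<close>.  The necessity of both conditions follows by
  exhibiting relations: the vanishing sum of the \<open>p\<close>-th roots of unity, and the expansion of an element
  of the intersection in powers of \<open>z\<close>.  For sufficiency, the minimal polynomial of \<open>z\<close> over \<open>K\<close> has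
  coefficients in \<open>K \<inter> E\<^sub>n\<close>, hence in \<open>\<rat>(z\<^sup>p)\<close>.  When \<open>p\<^sup>2\<close> divides \<open>n\<close>, multiplying \<open>z\<close> by a \<open>p\<close>-th root of
  unity is a Galois conjugation over this field.  So it preserves the set of roots of
  the minimal polynomial, and Fourier inversion over the \<open>p\<close>-th roots of unity isolates the classes of
  exponents (\<open>graded_relations_if_intersection\<close>).  The only deep input is the irreducibility of the
  cyclotomic polynomials, in the form of \<open>rational_poly_conjugate\<close>.

  Finally the inclusion of \<open>K \<inter> E\<^sub>n\<close> means that \<^const>\<open>kappa\<close> contains \<open>p\<close> to a smaller power than \<open>n\<close> does
  (\<open>multiplicity_kappa_less_iff\<close>), and a prime \<open>p\<close> with \<open>p\<^sup>2\<close> dividing \<open>n\<close> for which this happens is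
  exactly a witness that \<open>n\<close> does not divide the supernatural number in question.
\<close>

section \<open>Polynomials over a subfield of the complex numbers\<close>

text \<open>
  Fields are carried as subsets of \<^typ>\<open>complex\<close> and polynomials over them as complex polynomials with
  restricted coefficients.  Evaluation at arbitrary complex numbers and the fundamental theorem of
  algebra then apply without any change of type.
\<close>

locale complex_subfield =
  fixes K :: "complex set"
  assumes one_mem: "1 \<in> K"
    and diff_mem: "x \<in> K \<Longrightarrow> y \<in> K \<Longrightarrow> x - y \<in> K"
    and mult_mem: "x \<in> K \<Longrightarrow> y \<in> K \<Longrightarrow> x * y \<in> K"
    and inverse_mem: "x \<in> K \<Longrightarrow> inverse x \<in> K"
begin

lemma zero_mem: "0 \<in> K"
  using diff_mem[OF one_mem one_mem] by simp

lemma minus_mem: "x \<in> K \<Longrightarrow> - x \<in> K"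
  using diff_mem[OF zero_mem] by simp

lemma add_mem: "x \<in> K \<Longrightarrow> y \<in> K \<Longrightarrow> x + y \<in> K"
  using diff_mem[of x "- y"] minus_mem by simp

lemma divide_mem: "x \<in> K \<Longrightarrow> y \<in> K \<Longrightarrow> x / y \<in> K"
  by (simp add: divide_inverse mult_mem inverse_mem)

lemma of_int_mem: "of_int m \<in> K"
  by (induction m rule: int_induct[where k = 0])
    (auto intro: add_mem diff_mem one_mem zero_mem)

lemma Rats_subset: "\<rat> \<subseteq> K"
  by (auto elim!: Rats_cases' intro: divide_mem of_int_mem)

lemma sum_mem: "(\<And>i. i \<in> A \<Longrightarrow> f i \<in> K) \<Longrightarrow> sum f A \<in> K"
  by (induction A rule: infinite_finite_induct) (auto intro: add_mem zero_mem)

end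

lemma complex_subfield_Rats: "complex_subfield \<rat>"
  by unfold_locales auto

definition polys_over :: "complex set \<Rightarrow> complex poly set" where
  "polys_over K = {f. \<forall>i. coeff f i \<in> K}"

definition adjoin :: "complex set \<Rightarrow> complex \<Rightarrow> complex set" where
  "adjoin K z = (\<lambda>f. poly f z) ` polys_over K"

lemma polys_over_mono: "K \<subseteq> L \<Longrightarrow> polys_over K \<subseteq> polys_over L"
  by (auto simp: polys_over_def)

lemma adjoinI: "f \<in> polys_over K \<Longrightarrow> poly f z \<in> adjoin K z"
  by (auto simp: adjoin_def)

context complex_subfield
begin

lemma polys_over_0: "0 \<in> polys_over K"
  by (simp add: polys_over_def zero_mem)

lemma polys_over_monom: "c \<in> K \<Longrightarrow> monom c m \<in> polys_over K"
  by (simp add: polys_over_def zero_mem)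

lemma polys_over_const: "c \<in> K \<Longrightarrow> [:c:] \<in> polys_over K"
  using polys_over_monom[of c 0] by (simp add: monom_0)

lemma polys_over_1: "1 \<in> polys_over K"
  using polys_over_const[OF one_mem] by (simp add: one_pCons)

lemma polys_over_add: "f \<in> polys_over K \<Longrightarrow> g \<in> polys_over K \<Longrightarrow> f + g \<in> polys_over K"
  by (simp add: polys_over_def add_mem)

lemma polys_over_diff: "f \<in> polys_over K \<Longrightarrow> g \<in> polys_over K \<Longrightarrow> f - g \<in> polys_over K"
  by (simp add: polys_over_def diff_mem)

lemma polys_over_mult: "f \<in> polys_over K \<Longrightarrow> g \<in> polys_over K \<Longrightarrow> f * g \<in> polys_over K"
  by (simp add: polys_over_def coeff_mult sum_mem mult_mem)

lemma polys_over_smult: "c \<in> K \<Longrightarrow> f \<in> polys_over K \<Longrightarrow> Polynomial.smult c f \<in> polys_over K"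
  by (simp add: polys_over_def mult_mem)

lemma polys_over_sum: "(\<And>i. i \<in> A \<Longrightarrow> f i \<in> polys_over K) \<Longrightarrow> sum f A \<in> polys_over K"
  by (induction A rule: infinite_finite_induct) (auto intro: polys_over_add polys_over_0)

lemma polys_over_power: "f \<in> polys_over K \<Longrightarrow> f ^ m \<in> polys_over K"
  by (induction m) (auto intro: polys_over_mult polys_over_1)

lemma polys_over_pCons_iff: "pCons a f \<in> polys_over K \<longleftrightarrow> a \<in> K \<and> f \<in> polys_over K"
  by (auto simp: polys_over_def coeff_pCons split: nat.splits)

lemma polys_over_pcompose:
  assumes "f \<in> polys_over K" "g \<in> polys_over K"
  shows "pcompose f g \<in> polys_over K"
  using assms(1)
  by (induction f)
    (auto simp: pcompose_pCons polys_over_pCons_iff polys_over_0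
      intro!: polys_over_add polys_over_mult polys_over_const assms(2))

text \<open>
  The polynomials over \<open>K\<close> form a principal ideal domain: a nonzero element \<open>m\<close> of least degree
  divides every other one, since subtracting a suitable multiple of \<open>m\<close> cancels the leading
  coefficient without leaving the ideal.
\<close>

lemma ideal_generator:
  assumes J: "J \<subseteq> polys_over K"
    and diff: "\<And>f g. f \<in> J \<Longrightarrow> g \<in> J \<Longrightarrow> f - g \<in> J"
    and mult: "\<And>f h. f \<in> J \<Longrightarrow> h \<in> polys_over K \<Longrightarrow> h * f \<in> J"
    and nz: "f0 \<in> J" "f0 \<noteq> 0"
  obtains m where "m \<in> J" "m \<noteq> 0" "\<And>f. f \<in> J \<Longrightarrow> \<exists>h\<in>polys_over K. f = h * m"
proof -
  obtain m where m: "m \<in> J" "m \<noteq> 0"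
    and min: "\<And>f. f \<in> J \<Longrightarrow> f \<noteq> 0 \<Longrightarrow> degree m \<le> degree f"
    using ex_has_least_nat[of "\<lambda>f. f \<in> J \<and> f \<noteq> 0" f0 degree] nz by blast
  have "\<exists>h\<in>polys_over K. f = h * m" if "f \<in> J" for f
    using that
  proof (induction "degree f" arbitrary: f rule: less_induct)
    case less
    show ?case
    proof (cases "f = 0")
      case True
      then show ?thesis
        using polys_over_0 by auto
    next
      case False
      define c where "c = lead_coeff f / lead_coeff m"
      define q where "q = monom c (degree f - degree m)"
      have le: "degree m \<le> degree f"
        using min less.prems False by blast
      have "c \<in> K"
        using less.prems m(1) J unfolding c_def polys_over_def by (auto intro!: divide_mem)
      then have q: "q \<in> polys_over K"
        unfolding q_def by (rule polys_over_monom)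
      have fJ: "f - q * m \<in> J"
        using diff[OF less.prems mult[OF m(1) q]] .
      have "c \<noteq> 0"
        using False m(2) by (simp add: c_def)
      then have dq: "degree (q * m) = degree f"
        using le m(2) by (simp add: q_def degree_mult_eq degree_monom_eq)
      have "lead_coeff (q * m) = lead_coeff f"
        using \<open>c \<noteq> 0\<close> m(2)
        by (simp only: lead_coeff_mult) (simp add: q_def degree_monom_eq c_def)
      then have coeff0: "coeff (f - q * m) (degree f) = 0"
        using dq by simp
      have dle: "degree (f - q * m) \<le> degree f"
        using degree_diff_le[of f "degree f" "q * m"] dq by simp
      have "\<exists>h\<in>polys_over K. f - q * m = h * m"
      proof (cases "f - q * m = 0")
        case True
        then show ?thesis
          using polys_over_0 by auto
      next
        case nz: False
        then have "degree (f - q * m) \<noteq> degree f"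
          using coeff0 by (metis leading_coeff_0_iff)
        then show ?thesis
          using less.hyps[OF _ fJ] dle by linarith
      qed
      then obtain h where "h \<in> polys_over K" "f - q * m = h * m" by blast
      then show ?thesis
        using q by (intro bexI[of _ "h + q"]) (auto simp: algebra_simps polys_over_add)
    qed
  qed
  with m show thesis
    using that by blast
qed

lemma adjoin_base: "c \<in> K \<Longrightarrow> c \<in> adjoin K z"
  using adjoinI[OF polys_over_const, of c z] by simp

lemma adjoin_gen: "z \<in> adjoin K z"
  using adjoinI[OF polys_over_monom[OF one_mem], of 1 z] by (simp add: poly_monom)

lemma adjoin_add: "x \<in> adjoin K z \<Longrightarrow> y \<in> adjoin K z \<Longrightarrow> x + y \<in> adjoin K z"
  by (auto simp: adjoin_def image_iff intro: bexI[OF _ polys_over_add])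

lemma adjoin_diff: "x \<in> adjoin K z \<Longrightarrow> y \<in> adjoin K z \<Longrightarrow> x - y \<in> adjoin K z"
  by (auto simp: adjoin_def image_iff intro: bexI[OF _ polys_over_diff])

lemma adjoin_mult: "x \<in> adjoin K z \<Longrightarrow> y \<in> adjoin K z \<Longrightarrow> x * y \<in> adjoin K z"
  by (auto simp: adjoin_def image_iff intro: bexI[OF _ polys_over_mult])

lemma adjoin_power: "x \<in> adjoin K z \<Longrightarrow> x ^ m \<in> adjoin K z"
  by (induction m) (auto intro: adjoin_mult adjoin_base one_mem)

lemma adjoin_sum:
  "(\<And>i. i \<in> A \<Longrightarrow> f i \<in> adjoin K z) \<Longrightarrow> sum f A \<in> adjoin K z"
  by (induction A rule: infinite_finite_induct) (auto intro: adjoin_add adjoin_base zero_mem)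

lemma adjoin_subset: "w \<in> adjoin K z \<Longrightarrow> adjoin K w \<subseteq> adjoin K z"
  by (auto simp: adjoin_def image_iff simp flip: poly_pcompose
      intro: bexI[OF _ polys_over_pcompose])

lemma minimal_polynomial:
  assumes "f0 \<in> polys_over K" "f0 \<noteq> 0" "poly f0 z = 0"
  obtains m where "m \<in> polys_over K" "m \<noteq> 0" "poly m z = 0"
    "\<And>f. f \<in> polys_over K \<Longrightarrow> poly f z = 0 \<Longrightarrow> \<exists>h\<in>polys_over K. f = h * m"
proof -
  let ?J = "{f \<in> polys_over K. poly f z = 0}"
  obtain m where "m \<in> ?J" "m \<noteq> 0" "\<And>f. f \<in> ?J \<Longrightarrow> \<exists>h\<in>polys_over K. f = h * m"
  proof (rule ideal_generator[of ?J f0])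
    show "f - g \<in> ?J" if "f \<in> ?J" "g \<in> ?J" for f g
      using that by (simp add: polys_over_diff)
    show "h * f \<in> ?J" if "f \<in> ?J" "h \<in> polys_over K" for f h
      using that by (simp add: polys_over_mult)
  qed (use assms in auto)
  then show thesis
    using that by auto
qed

text \<open>
  The ideal generated by the minimal polynomial \<open>\<mu>\<close> of \<open>z\<close> and a polynomial that does not vanish at \<open>z\<close>
  is the whole ring, because \<open>\<mu>\<close> has no proper divisors.
\<close>

lemma complex_subfield_adjoin:
  assumes "f0 \<in> polys_over K" "f0 \<noteq> 0" "poly f0 z = 0"
  shows "complex_subfield (adjoin K z)"
proof
  fix x assume "x \<in> adjoin K z"
  then obtain f where f: "f \<in> polys_over K" "x = poly f z"
    by (auto simp: adjoin_def)
  obtain \<mu> where \<mu>: "\<mu> \<in> polys_over K" "\<mu> \<noteq> 0" "poly \<mu> z = 0"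
    and \<mu>_dvd: "\<And>f. f \<in> polys_over K \<Longrightarrow> poly f z = 0 \<Longrightarrow> \<exists>h\<in>polys_over K. f = h * \<mu>"
    using minimal_polynomial[OF assms] by blast
  show "inverse x \<in> adjoin K z"
  proof (cases "x = 0")
    case True
    then show ?thesis
      by (simp add: adjoin_base zero_mem)
  next
    case False
    define J where "J = {a * f + b * \<mu> | a b. a \<in> polys_over K \<and> b \<in> polys_over K}"
    have J: "a * f + b * \<mu> \<in> J" if "a \<in> polys_over K" "b \<in> polys_over K" for a b
      using that by (auto simp: J_def)
    have J_sub: "J \<subseteq> polys_over K"
      using f \<mu> by (auto simp: J_def intro!: polys_over_add polys_over_mult)
    have "f \<in> J" "\<mu> \<in> J"
      using J[OF polys_over_1 polys_over_0] J[OF polys_over_0 polys_over_1] by simp_all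
    obtain m where m: "m \<in> J" "m \<noteq> 0" "\<And>u. u \<in> J \<Longrightarrow> \<exists>h\<in>polys_over K. u = h * m"
    proof (rule ideal_generator[of J \<mu>])
      show "J \<subseteq> polys_over K"
        by (rule J_sub)
      show "u - v \<in> J" if "u \<in> J" "v \<in> J" for u v
      proof -
        from that obtain a b a' b' where "u = a * f + b * \<mu>" "v = a' * f + b' * \<mu>"
          and mem: "a \<in> polys_over K" "b \<in> polys_over K" "a' \<in> polys_over K" "b' \<in> polys_over K"
          by (auto simp: J_def)
        then have "u - v = (a - a') * f + (b - b') * \<mu>"
          by (simp add: algebra_simps)
        then show ?thesis
          using J[OF polys_over_diff polys_over_diff] mem by simp
      qed
      show "h * u \<in> J" if "u \<in> J" "h \<in> polys_over K" for u h
      proof -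
        from that obtain a b where "u = a * f + b * \<mu>"
          and mem: "a \<in> polys_over K" "b \<in> polys_over K"
          by (auto simp: J_def)
        then have "h * u = (h * a) * f + (h * b) * \<mu>"
          by (simp add: algebra_simps)
        then show ?thesis
          using J[OF polys_over_mult polys_over_mult] mem that(2) by simp
      qed
    qed (use \<mu> \<open>\<mu> \<in> J\<close> in auto)
    obtain a b where ab: "a \<in> polys_over K" "m = a * f + b * \<mu>"
      using m(1) by (auto simp: J_def)
    obtain h where "f = h * m"
      using m(3)[OF \<open>f \<in> J\<close>] by blast
    then have mz: "poly m z \<noteq> 0"
      using False f by auto
    obtain h' where h': "h' \<in> polys_over K" "\<mu> = h' * m"
      using m(3)[OF \<open>\<mu> \<in> J\<close>] by blast
    with \<mu> mz have "poly h' z = 0"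
      by simp
    then obtain h'' where "h' = h'' * \<mu>"
      using \<mu>_dvd h'(1) by blast
    then have "h'' * \<mu> * m = \<mu>"
      using h'(2) by metis
    then have "\<mu> * (h'' * m) = \<mu> * 1"
      by (simp add: ac_simps)
    then have "h'' * m = 1"
      using \<mu>(2) unfolding mult_cancel_left by simp
    \<comment> \<open>So the generator is a unit, and Bezout's identity evaluated at the root inverts \<open>x\<close>.\<close>
    then have "degree m = 0"
      using m(2) is_unit_iff_degree[of m] by (metis dvd_triv_right)
    then obtain c where c: "m = [:c:]"
      by (metis degree_eq_zeroE)
    have "c \<in> K"
      using J_sub m(1) c by (auto simp: polys_over_pCons_iff)
    have "c = poly a z * x"
      using arg_cong[OF ab(2), of "\<lambda>g. poly g z"] c f \<mu> by simp
    moreover have "c \<noteq> 0"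
      using c m(2) by auto
    ultimately have "inverse x = inverse c * poly a z"
      using False by (simp add: field_simps)
    then show ?thesis
      using adjoin_mult[OF adjoin_base[OF inverse_mem[OF \<open>c \<in> K\<close>]] adjoinI[OF ab(1)]] by simp
  qed
qed (auto intro: adjoin_base one_mem adjoin_diff adjoin_mult)

end

section \<open>Roots of unity\<close>

definition primitive_root_unity :: "nat \<Rightarrow> complex \<Rightarrow> bool" where
  "primitive_root_unity n z \<longleftrightarrow> (\<forall>j. z ^ j = 1 \<longleftrightarrow> n dvd j)"

lemma primitive_root_unity_power_eq_1: "primitive_root_unity n z \<Longrightarrow> z ^ n = 1"
  by (simp add: primitive_root_unity_def)

lemma primitive_root_unity_nonzero: "primitive_root_unity n z \<Longrightarrow> n > 0 \<Longrightarrow> z \<noteq> 0"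
  using primitive_root_unity_power_eq_1[of n z] by (auto simp: power_0_left)

lemma primitive_root_unity_cis:
  assumes "n > 0"
  shows "primitive_root_unity n (cis (2 * pi / real n))"
  unfolding primitive_root_unity_def
proof
  fix j
  have "cis (2 * pi / real n) ^ j = 1 \<longleftrightarrow> (\<exists>k::int. 2 * pi / real n * real j = 2 * pi * k)"
    unfolding DeMoivre
    using cos_one_sin_zero[of "real j * (2 * pi / real n)"] cos_one_2pi_int[of "real j * (2 * pi / real n)"]
    by (auto simp: complex_eq_iff mult_ac)
  also have "\<dots> \<longleftrightarrow> (\<exists>k::int. real j = real n * k)"
    using assms by (simp add: field_simps)
  also have "\<dots> \<longleftrightarrow> (\<exists>k::int. int j = int n * k)"
    by (metis (mono_tags, opaque_lifting) of_int_eq_iff of_int_mult of_int_of_nat_eq)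
  also have "\<dots> \<longleftrightarrow> n dvd j"
    by (metis dvd_def int_dvd_int_iff)
  finally show "cis (2 * pi / real n) ^ j = 1 \<longleftrightarrow> n dvd j" .
qed

lemma primitive_root_unity_power_cong:
  assumes z: "primitive_root_unity n z" and "n > 0"
  shows "z ^ i = z ^ j \<longleftrightarrow> [i = j] (mod n)"
proof -
  have *: "z ^ i = z ^ j \<longleftrightarrow> [i = j] (mod n)" if "i \<le> j" for i j
  proof -
    have "z ^ j = z ^ i * z ^ (j - i)"
      using that by (simp flip: power_add)
    then have "z ^ i = z ^ j \<longleftrightarrow> z ^ (j - i) = 1"
      using primitive_root_unity_nonzero[OF assms] by simp
    also have "\<dots> \<longleftrightarrow> [j = i] (mod n)"
      using z that by (simp add: primitive_root_unity_def cong_altdef_nat)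
    also have "\<dots> \<longleftrightarrow> [i = j] (mod n)"
      by (rule cong_sym_eq)
    finally show ?thesis .
  qed
  show ?thesis
    using *[of i j] *[of j i] by (metis cong_sym nle_le)
qed

lemma primitive_root_unity_power:
  assumes "primitive_root_unity (n * m) z" "m > 0"
  shows "primitive_root_unity n (z ^ m)"
  using assms unfolding primitive_root_unity_def
  by (simp add: mult.commute[of n] flip: power_mult)

lemma primitive_root_unity_generates:
  assumes z: "primitive_root_unity n z" and n: "n > 0" and w: "w ^ n = 1"
  obtains j where "j < n" "w = z ^ j"
proof -
  have "inj_on (\<lambda>j. z ^ j) {..<n}"
    by (auto simp: inj_on_def primitive_root_unity_power_cong[OF z n] cong_less_modulus_unique_nat)
  then have "card ((\<lambda>j. z ^ j) ` {..<n}) = card {x::complex. x ^ n = 1}"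
    using n by (simp add: card_image card_roots_unity_eq)
  moreover have "(\<lambda>j. z ^ j) ` {..<n} \<subseteq> {x. x ^ n = 1}"
    using z by (auto simp: primitive_root_unity_def mult.commute simp flip: power_mult)
  moreover have "finite {x::complex. x ^ n = 1}"
    using n by (intro finite_roots_unity) simp
  ultimately have "(\<lambda>j. z ^ j) ` {..<n} = {x. x ^ n = 1}"
    by (intro card_subset_eq)
  with w show thesis
    using that by blast
qed

lemma root_unity_poly:
  fixes z :: complex
  assumes "n > 0" "z ^ n = 1"
  shows "poly (monom 1 n - 1) z = 0" "monom 1 n - 1 \<noteq> (0 :: complex poly)"
    "monom 1 n - 1 \<in> polys_over \<rat>"
proof -
  show "poly (monom 1 n - 1) z = 0"
    using assms by (simp add: poly_monom)
  have "coeff (monom 1 n - 1 :: complex poly) n = 1"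
    using assms by simp
  then show "monom 1 n - 1 \<noteq> (0 :: complex poly)"
    by (metis coeff_0 zero_neq_one)
  interpret Q: complex_subfield \<rat>
    by (rule complex_subfield_Rats)
  show "monom 1 n - 1 \<in> polys_over \<rat>"
    by (intro Q.polys_over_diff Q.polys_over_monom Q.polys_over_1) simp
qed

text \<open>
  All primitive roots of unity of order \<open>n\<close> are powers of each other, so that the root \<open>z\<close> which arises
  as an eigenvalue can replace the standard one.  Closure of \<^term>\<open>adjoin \<rat> z\<close> under inverses makes
  polynomial expressions in \<open>z\<close> sufficient.
\<close>

lemma cyclotomic_field_eq_adjoin:
  assumes z: "primitive_root_unity n z" and n: "n > 0"
  shows "cyclotomic_field n = adjoin \<rat> z"
proof -
  interpret Q: complex_subfield \<rat>
    by (rule complex_subfield_Rats)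
  interpret L: complex_subfield "adjoin \<rat> z"
    using Q.complex_subfield_adjoin root_unity_poly[OF n primitive_root_unity_power_eq_1[OF z]]
    by blast
  define w where "w = cis (2 * pi / real n)"
  have w: "primitive_root_unity n w"
    using n unfolding w_def by (rule primitive_root_unity_cis)
  let ?F = "class_ring :: complex ring"
  have inv: "m_inv ?F x = inverse x" if "x \<noteq> 0" for x
    using that by (simp add: class_ring_simps)
  obtain i where i: "w = z ^ i"
    using primitive_root_unity_generates[OF z n primitive_root_unity_power_eq_1[OF w]] by blast
  obtain j where j: "z = w ^ j"
    using primitive_root_unity_generates[OF w n primitive_root_unity_power_eq_1[OF z]] by blast
  show ?thesis
  proof
    have "x \<in> adjoin \<rat> z" if "x \<in> generate_field ?F (\<rat> \<union> {w})" for x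
      using that
    proof induction
      case (incl h)
      then show ?case
        using i by (auto intro: Q.adjoin_base Q.adjoin_power Q.adjoin_gen)
    next
      case (m_inv h)
      then show ?case
        by (simp add: inv L.inverse_mem)
    qed (auto simp: class_ring_simps intro: L.one_mem L.minus_mem L.add_mem L.mult_mem)
    then show "cyclotomic_field n \<subseteq> adjoin \<rat> z"
      unfolding cyclotomic_field_def w_def by blast
  next
    define S where "S = generate_field ?F (\<rat> \<union> {w})"
    have base: "c \<in> S" if "c \<in> \<rat> \<union> {w}" for c
      using that unfolding S_def by (rule generate_field.incl)
    have add: "x + y \<in> S" and mult: "x * y \<in> S" if "x \<in> S" "y \<in> S" for x y
      using that generate_field.eng_add[of x ?F _ y] generate_field.eng_mult[of x ?F _ y]
      by (simp_all add: S_def)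
    have "w ^ k \<in> S" for k
      by (induction k) (auto intro: mult base)
    then have z_S: "z \<in> S"
      using j by simp
    have "poly f z \<in> S" if "f \<in> polys_over \<rat>" for f
      using that by (induction f) (auto simp: Q.polys_over_pCons_iff intro: base add mult z_S)
    then show "adjoin \<rat> z \<subseteq> cyclotomic_field n"
      unfolding cyclotomic_field_def S_def w_def adjoin_def by blast
  qed
qed

section \<open>Relations graded by the exponent modulo \<open>p\<close>\<close>

text \<open>
  The polynomial ring is graded by the exponents modulo \<open>p\<close>; this is the component of class \<open>a\<close> of \<open>f\<close>.
\<close>

definition part :: "nat \<Rightarrow> nat \<Rightarrow> complex poly \<Rightarrow> complex poly" where
  "part p a f = Abs_poly (\<lambda>i. if [i = a] (mod p) then coeff f i else 0)"

lemma coeff_part: "coeff (part p a f) i = (if [i = a] (mod p) then coeff f i else 0)"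
  unfolding part_def by (subst coeff_Abs_poly[of "degree f"]) (auto simp: coeff_eq_0)

lemma part_cong: "[a = b] (mod p) \<Longrightarrow> part p a f = part p b f"
  by (intro poly_eqI) (metis coeff_part cong_sym cong_trans)

lemma part_diff: "part p a (f - g) = part p a f - part p a g"
  by (intro poly_eqI) (simp add: coeff_part)

lemma part_sum: "part p a (sum f A) = (\<Sum>i\<in>A. part p a (f i))"
  by (intro poly_eqI) (simp add: coeff_part coeff_sum)

lemma part_part: "part p a (part p b f) = (if [a = b] (mod p) then part p a f else 0)"
  by (intro poly_eqI) (auto simp: coeff_part dest: cong_trans cong_sym)

lemma part_monom: "part p a (monom c i) = (if [i = a] (mod p) then monom c i else 0)"
  by (intro poly_eqI) (auto simp: coeff_part)

lemma sum_parts: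
  assumes "p > 0"
  shows "(\<Sum>a<p. part p a f) = f"
proof (rule poly_eqI)
  fix i
  have "[i = a] (mod p) \<longleftrightarrow> a = i mod p" if "a < p" for a
    using that by (auto simp: cong_def)
  then have "coeff (\<Sum>a<p. part p a f) i = (\<Sum>a<p. if a = i mod p then coeff f i else 0)"
    by (auto simp: coeff_sum coeff_part intro!: sum.cong)
  also have "\<dots> = coeff f i"
    using assms by simp
  finally show "coeff (\<Sum>a<p. part p a f) i = coeff f i" .
qed

lemma (in complex_subfield) polys_over_part: "f \<in> polys_over K \<Longrightarrow> part p a f \<in> polys_over K"
  by (simp add: polys_over_def coeff_part zero_mem)

lemma poly_part:
  "poly (part p a f) z = (\<Sum>j\<le>degree f. if [j = a] (mod p) then coeff f j * z ^ j else 0)"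
proof -
  have "degree (part p a f) \<le> degree f"
    by (rule degree_le) (auto simp: coeff_part coeff_eq_0)
  then have "poly (part p a f) z = (\<Sum>j\<le>degree f. coeff (part p a f) j * z ^ j)"
    unfolding poly_altdef by (intro sum.mono_neutral_left) (auto simp: coeff_eq_0)
  also have "\<dots> = (\<Sum>j\<le>degree f. if [j = a] (mod p) then coeff f j * z ^ j else 0)"
    by (intro sum.cong) (auto simp: coeff_part)
  finally show ?thesis .
qed

text \<open>
  The ideal of relations of \<open>z\<close> over \<open>K\<close> is homogeneous for this grading.  For a root of unity \<open>z\<close> and
  \<open>p > 0\<close> this says $[K(z) : K(z^p)] = p$.
\<close>

definition graded_relations :: "complex set \<Rightarrow> nat \<Rightarrow> complex \<Rightarrow> bool" where
  "graded_relations K p z \<longleftrightarrow>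
     (\<forall>f\<in>polys_over K. poly f z = 0 \<longrightarrow> (\<forall>a. poly (part p a f) z = 0))"

text \<open>
  Fourier inversion on the group of \<open>p\<close>-th roots of unity: by orthogonality of characters the weighted
  sum of the values at \<open>w ^ i * z\<close> keeps exactly the exponents congruent to \<open>a\<close>.
\<close>

lemma poly_part_fourier:
  assumes w: "primitive_root_unity p w" and p: "p > 0"
  shows "of_nat p * poly (part p a f) z = (\<Sum>i<p. inverse (w ^ (i * a)) * poly f (w ^ i * z))"
proof -
  have w0: "w \<noteq> 0"
    using primitive_root_unity_nonzero[OF w p] .
  have orth: "(\<Sum>i<p. inverse (w ^ (i * a)) * w ^ (i * j)) = (if [j = a] (mod p) then of_nat p else 0)"
    for j
  proof -
    define q where "q = w ^ j / w ^ a"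
    have "(\<Sum>i<p. inverse (w ^ (i * a)) * w ^ (i * j)) = (\<Sum>i<p. q ^ i)"
      by (simp add: q_def power_divide field_simps flip: power_mult)
    moreover have "q ^ p = 1"
      using primitive_root_unity_power_eq_1[OF w] power_mult[of w p]
      by (simp add: q_def power_divide mult.commute[of _ p] flip: power_mult)
    moreover have "q = 1 \<longleftrightarrow> [j = a] (mod p)"
      using w0 primitive_root_unity_power_cong[OF w p, of j a] by (simp add: q_def)
    ultimately show ?thesis
      by (auto simp: sum_gp_strict)
  qed
  have "of_nat p * poly (part p a f) z =
      (\<Sum>j\<le>degree f. coeff f j * z ^ j * (if [j = a] (mod p) then of_nat p else 0))"
    unfolding poly_part sum_distrib_left by (intro sum.cong) auto
  also have "\<dots> = (\<Sum>j\<le>degree f. \<Sum>i<p. coeff f j * z ^ j * (inverse (w ^ (i * a)) * w ^ (i * j)))"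
    unfolding orth[symmetric] by (simp add: sum_distrib_left)
  also have "\<dots> = (\<Sum>i<p. \<Sum>j\<le>degree f. coeff f j * z ^ j * (inverse (w ^ (i * a)) * w ^ (i * j)))"
    by (rule sum.swap)
  also have "\<dots> = (\<Sum>i<p. inverse (w ^ (i * a)) * poly f (w ^ i * z))"
    by (simp add: poly_altdef sum_distrib_left power_mult_distrib mult_ac flip: power_mult)
  finally show ?thesis .
qed

lemma graded_relationsI:
  assumes "primitive_root_unity p w" "p > 0"
    and "\<And>f i. f \<in> polys_over K \<Longrightarrow> poly f z = 0 \<Longrightarrow> poly f (w ^ i * z) = 0"
  shows "graded_relations K p z"
proof -
  have "of_nat p * poly (part p a f) z = 0" if "f \<in> polys_over K" "poly f z = 0" for f a
    using poly_part_fourier[OF assms(1,2), of a f z] assms(3)[OF that] by simp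
  with assms(2) show ?thesis
    by (simp add: graded_relations_def)
qed

section \<open>Galois conjugation of roots of unity over the rationals\<close>

text \<open>
  A rational relation satisfied by a root of unity \<open>z\<close> of order \<open>n\<close> is satisfied by all its powers
  \<open>z ^ t\<close> with \<open>t\<close> coprime to \<open>n\<close>; this is the irreducibility of the cyclotomic polynomials.  The
  proof follows Landau.  For a prime \<open>q\<close> the number \<open>f(z ^ q)\<close> is congruent to \<open>f(z) ^ q = 0\<close> modulo \<open>q\<close>
  in the ring $\mathbf{Z}[z]$.  The finitely many nonzero values \<open>f(z ^ k)\<close> are divisible by only
  finitely many integers there, so \<open>f(z ^ q) = 0\<close> for all large primes \<open>q\<close>; and every \<open>t\<close> coprime to \<open>n\<close>
  is congruent modulo \<open>n\<close> to a product of large primes.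
\<close>

abbreviation ipoly :: "int poly \<Rightarrow> complex \<Rightarrow> complex" where
  "ipoly f z \<equiv> poly (map_poly of_int f) z"

lemma ipoly_pCons: "ipoly (pCons a f) z = of_int a + z * ipoly f z"
  by (simp add: map_poly_pCons)

lemma ipoly_add: "ipoly (f + g) z = ipoly f z + ipoly g z"
proof -
  have "map_poly of_int (f + g) = (map_poly of_int f + map_poly of_int g :: complex poly)"
    by (intro poly_eqI) (simp add: coeff_map_poly)
  then show ?thesis by simp
qed

lemma ipoly_smult: "ipoly (Polynomial.smult c f) z = of_int c * ipoly f z"
  by (simp add: map_poly_smult)

lemma ipoly_mult: "ipoly (f * g) z = ipoly f z * ipoly g z"
  by (induction f) (simp_all add: ipoly_pCons ipoly_add ipoly_smult algebra_simps)

lemma ipoly_power: "ipoly (f ^ m) z = ipoly f z ^ m"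
  by (induction m) (simp_all add: ipoly_mult)

lemma prime_dvd_power_add_diff:
  fixes x y :: "'a :: comm_ring_1"
  assumes q: "prime q"
  shows "of_nat q dvd (x + y) ^ q - (x ^ q + y ^ q)"
proof -
  have "q > 0"
    using q by (simp add: prime_gt_0_nat)
  then have split: "{..q} = insert 0 (insert q {0<..<q})"
    by auto
  have "(x + y) ^ q = (\<Sum>k\<le>q. of_nat (q choose k) * x ^ k * y ^ (q - k))"
    by (rule binomial_ring)
  also have "\<dots> = (x ^ q + y ^ q) + (\<Sum>k\<in>{0<..<q}. of_nat (q choose k) * x ^ k * y ^ (q - k))"
    using \<open>q > 0\<close> by (simp add: split)
  finally have "(x + y) ^ q - (x ^ q + y ^ q) =
      (\<Sum>k\<in>{0<..<q}. of_nat (q choose k) * x ^ k * y ^ (q - k))"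
    by simp
  also have "of_nat q dvd \<dots>"
  proof (intro dvd_sum dvd_mult2)
    fix k assume "k \<in> {0<..<q}"
    then have "q dvd (q choose k)"
      using q by (intro dvd_choose_prime) auto
    then show "of_nat q dvd (of_nat (q choose k) :: 'a)"
      by (metis dvd_def of_nat_mult)
  qed
  finally show ?thesis .
qed

lemma prime_dvd_int_power_diff:
  assumes q: "prime q"
  shows "int q dvd a ^ q - a"
proof (induction a rule: int_induct[where k = 0])
  case base
  then show ?case
    using q by (simp add: power_0_left)
next
  case (step1 a)
  then show ?case
    using dvd_add[OF prime_dvd_power_add_diff[OF q, of a 1] step1(2)] by (simp add: algebra_simps)
next
  case (step2 a)
  then show ?case
    using dvd_diff[OF step2(2) prime_dvd_power_add_diff[OF q, of "a - 1" 1]] by (simp add: algebra_simps)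
qed

text \<open>
  The Frobenius congruence, in the form that the difference of both sides is \<open>q\<close> times an element of
  $\mathbf{Z}[z]$.
\<close>

lemma ipoly_frobenius:
  assumes q: "prime q"
  shows "\<exists>h. ipoly f (z ^ q) = ipoly f z ^ q + of_nat q * ipoly h z"
proof (induction f)
  case 0
  have "ipoly 0 (z ^ q) = ipoly 0 z ^ q + of_nat q * ipoly 0 z"
    using q by (simp add: power_0_left)
  then show ?case by blast
next
  case (pCons a f)
  then obtain h where h: "ipoly f (z ^ q) = ipoly f z ^ q + of_nat q * ipoly h z"
    by blast
  let ?X = "[:0, 1:] :: int poly"
  have "pCons a f = [:a:] + ?X * f"
    by simp
  then have "of_nat q dvd (pCons a f) ^ q - ([:a:] ^ q + (?X * f) ^ q)"
    using prime_dvd_power_add_diff[OF q, of "[:a:]" "?X * f"] by simp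
  then obtain u where "(pCons a f) ^ q - ([:a:] ^ q + (?X * f) ^ q) = of_nat q * u"
    by (elim dvdE)
  then have u: "[:a:] ^ q + (?X * f) ^ q + of_nat q * u = (pCons a f) ^ q"
    by (simp add: algebra_simps)
  have nat: "ipoly (of_nat q) z = of_nat q"
    by (simp add: of_nat_poly map_poly_pCons)
  have "ipoly (pCons a f) z ^ q = of_int a ^ q + z ^ q * ipoly f z ^ q + of_nat q * ipoly u z"
    using arg_cong[OF u, of "\<lambda>g. ipoly g z"]
    by (simp add: ipoly_add ipoly_mult ipoly_power ipoly_pCons nat power_mult_distrib)
  moreover obtain b where "a ^ q = a - int q * b"
  proof -
    have "int q dvd a - a ^ q"
      using prime_dvd_int_power_diff[OF q] by (simp add: dvd_diff_commute)
    then obtain b where "a - a ^ q = int q * b"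
      by (elim dvdE)
    then show thesis
      using that[of b] by simp
  qed
  then have "of_int a ^ q = (of_int a - of_nat q * of_int b :: complex)"
    by (metis of_int_diff of_int_mult of_int_of_nat_eq of_int_power)
  ultimately have "ipoly (pCons a f) (z ^ q) = ipoly (pCons a f) z ^ q +
      of_nat q * (of_int b + z ^ q * ipoly h z - ipoly u z)"
    using h by (simp add: ipoly_pCons algebra_simps)
  also have "of_int b + z ^ q * ipoly h z - ipoly u z = ipoly ([:b:] + ?X ^ q * h + Polynomial.smult (-1) u) z"
    unfolding ipoly_add ipoly_mult ipoly_power ipoly_smult by (simp add: ipoly_pCons)
  finally show ?case by blast
qed

lemma common_denominator:
  assumes "finite S" "\<And>s. s \<in> S \<Longrightarrow> x s \<in> (\<rat> :: 'a :: field_char_0 set)"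
  obtains D :: nat where "D > 0" "\<And>s. s \<in> S \<Longrightarrow> of_nat D * x s \<in> \<int>"
proof -
  have "\<exists>D::nat. D > 0 \<and> (\<forall>s\<in>S. of_nat D * x s \<in> \<int>)"
    using assms
  proof (induction S)
    case empty
    then show ?case by (intro exI[of _ 1]) simp
  next
    case (insert s S)
    then obtain D where D: "D > 0" "\<forall>s\<in>S. of_nat D * x s \<in> \<int>"
      by auto
    obtain a b where ab: "b > 0" "x s = of_int a / of_int b"
      using insert.prems[of s] by (auto elim: Rats_cases')
    have b: "of_nat (nat b) = (of_int b :: 'a)"
      using ab by simp
    have "of_nat (D * nat b) * x t \<in> \<int>" if "t \<in> insert s S" for t
    proof (cases "t = s")
      case True
      then have "of_nat (D * nat b) * x t = of_int (int D * a)"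
        using ab b by simp
      then show ?thesis
        by (metis Ints_of_int)
    next
      case False
      have "of_nat (D * nat b) * x t = of_nat (nat b) * (of_nat D * x t)"
        by simp
      moreover have "of_nat D * x t \<in> \<int>"
        using D that False by blast
      ultimately show ?thesis
        by (metis Ints_mult Ints_of_nat)
    qed
    then show ?case
      using D ab by (intro exI[of _ "D * nat b"]) auto
  qed
  then show thesis
    using that by blast
qed

text \<open>
  The functional is obtained by extending \<open>{x}\<close> to a basis of the complex numbers over the rationals.
  It detects divisibility by integers in $\mathbf{Z}[z]$ and thereby replaces an integral basis of this
  ring.
\<close>

lemma rational_functional:
  fixes x :: complex
  assumes "x \<noteq> 0"
  obtains L :: "complex \<Rightarrow> rat" where "L x = 1" "\<And>u v. L (u + v) = L u + L v"
    "\<And>r u. L (of_rat r * u) = r * L u"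
proof -
  interpret vector_space_pair "\<lambda>r u. of_rat r * u :: complex" "(*) :: rat \<Rightarrow> rat \<Rightarrow> rat"
    by unfold_locales (simp_all add: algebra_simps of_rat_add of_rat_mult)
  have "vs1.independent {x}"
    using assms by simp
  then obtain L where "Vector_Spaces.linear (\<lambda>r u. of_rat r * u) (*) L" "\<forall>y\<in>{x}. L y = 1"
    using linear_independent_extend[of "{x}" "\<lambda>_. 1"] by blast
  then interpret L: Vector_Spaces.linear "\<lambda>r u. of_rat r * u :: complex" "(*) :: rat \<Rightarrow> rat \<Rightarrow> rat" L
    by blast
  show thesis
    using that[of L] \<open>\<forall>y\<in>{x}. L y = 1\<close> L.add L.scale by simp
qed

text \<open>
  Let \<open>L\<close> be a rational functional with \<open>L x = 1\<close> and \<open>D\<close> a common denominator of its values at the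
  finitely many powers of \<open>z\<close>.  Then \<open>D * L\<close> is integral on $\mathbf{Z}[z]$, so an integer dividing \<open>x\<close>
  there divides \<open>D\<close>.
\<close>

lemma divisors_bounded:
  fixes x z :: complex
  assumes "x \<noteq> 0" "z ^ n = 1" "n > 0"
  shows "\<exists>D. \<forall>q h k. x = of_nat q * ipoly h (z ^ k) \<longrightarrow> q \<le> D"
proof -
  obtain L :: "complex \<Rightarrow> rat" where L: "L x = 1" "\<And>u v. L (u + v) = L u + L v"
    "\<And>r u. L (of_rat r * u) = r * L u"
    using rational_functional[OF assms(1)] by blast
  have L0: "L 0 = 0"
    using L(2)[of 0 0] by simp
  have Rats: "L (z ^ i) \<in> \<rat>" for i
    by (metis Rats_of_rat of_rat_eq_id id_apply)
  obtain D :: nat where D: "D > 0" "\<And>i. i \<in> {..<n} \<Longrightarrow> of_nat D * L (z ^ i) \<in> \<int>"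
    using common_denominator[of "{..<n}" "\<lambda>i. L (z ^ i)"] Rats by blast
  have DL: "of_nat D * L (z ^ i) \<in> \<int>" for i
  proof -
    have "z ^ i = (z ^ n) ^ (i div n) * z ^ (i mod n)"
      unfolding power_mult[symmetric] power_add[symmetric] by simp
    then show ?thesis
      using D(2)[of "i mod n"] assms by simp
  qed
  have L_int: "L (of_int c * u) = of_int c * L u" for c u
    using L(3)[of "of_int c" u] by simp
  have ints: "of_nat D * L (z ^ i * ipoly h (z ^ k)) \<in> \<int>" for h i k
  proof (induction h arbitrary: i)
    case 0
    then show ?case by (simp add: L0)
  next
    case (pCons a h)
    have "z ^ i * ipoly (pCons a h) (z ^ k) = of_int a * z ^ i + z ^ (i + k) * ipoly h (z ^ k)"
      by (simp add: ipoly_pCons power_add algebra_simps)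
    then have "of_nat D * L (z ^ i * ipoly (pCons a h) (z ^ k)) =
        of_int a * (of_nat D * L (z ^ i)) + of_nat D * L (z ^ (i + k) * ipoly h (z ^ k))"
      by (simp add: L L_int algebra_simps)
    then show ?case
      using pCons.IH DL by simp
  qed
  show ?thesis
  proof (intro exI[of _ D] allI impI)
    fix q h k
    assume x: "x = of_nat q * ipoly h (z ^ k)"
    have "of_nat D * L (ipoly h (z ^ k)) \<in> \<int>"
      using ints[of 0 h k] by simp
    then obtain c where c: "of_nat D * L (ipoly h (z ^ k)) = of_int c"
      by (elim Ints_cases)
    have "L x = of_nat q * L (ipoly h (z ^ k))"
      using L_int[of "int q"] x by simp
    then have "of_nat D = of_nat q * (of_nat D * L (ipoly h (z ^ k)))"
      using L(1) by simp
    then have "of_int (int D) = (of_int (int q * c) :: rat)"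
      using c by simp
    then have "int D = int q * c"
      by (simp only: of_int_eq_iff)
    then have "q dvd D"
      by (metis dvd_triv_left int_dvd_int_iff)
    then show "q \<le> D"
      using D(1) by (rule dvd_imp_le)
  qed
qed

text \<open>
  Only exponents with large prime factors are accessible to the congruence argument.  A given \<open>t\<close> is
  first shifted by a multiple of \<open>n\<close> to get rid of all its small prime factors.
\<close>

lemma ipoly_conjugate:
  assumes z: "z ^ n = 1" and n: "n > 0" and f: "ipoly f z = 0" and t: "coprime t n"
  shows "ipoly f (z ^ t) = 0"
proof -
  have "\<exists>B. \<forall>q h j. ipoly f (z ^ k) \<noteq> 0 \<longrightarrow> ipoly f (z ^ k) = of_nat q * ipoly h (z ^ j) \<longrightarrow> q \<le> B"
    for k
    using divisors_bounded[OF _ z n, of "ipoly f (z ^ k)"] by (cases "ipoly f (z ^ k) = 0") simp_all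
  then obtain B where B: "\<And>k q h j. ipoly f (z ^ k) \<noteq> 0 \<Longrightarrow>
      ipoly f (z ^ k) = of_nat q * ipoly h (z ^ j) \<Longrightarrow> q \<le> B k"
    using choice[of "\<lambda>k B. \<forall>q h j. ipoly f (z ^ k) \<noteq> 0 \<longrightarrow>
      ipoly f (z ^ k) = of_nat q * ipoly h (z ^ j) \<longrightarrow> q \<le> B"] by blast
  define A where "A = (\<Sum>k<n. B k)"
  have A: "q \<le> A" if "k < n" "ipoly f (z ^ k) \<noteq> 0" "ipoly f (z ^ k) = of_nat q * ipoly h (z ^ j)"
    for k q h j
    using B[OF that(2,3)] member_le_sum[of k "{..<n}" B] that(1) by (simp add: A_def)
  have zmod: "z ^ (k mod n) = z ^ k" for k
  proof -
    have "z ^ k = (z ^ n) ^ (k div n) * z ^ (k mod n)"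
      unfolding power_mult[symmetric] power_add[symmetric] by simp
    then show ?thesis
      using z by simp
  qed
  \<comment> \<open>A large prime power map preserves the roots of \<open>f\<close> among the powers of \<open>z\<close>.\<close>
  have step: "ipoly f (z ^ (k * q)) = 0" 
    if q: "prime q" "q > A" "ipoly f (z ^ k) = 0" for k q
  proof (rule ccontr)
    assume "ipoly f (z ^ (k * q)) \<noteq> 0"
    moreover obtain h where "ipoly f ((z ^ k) ^ q) = ipoly f (z ^ k) ^ q + of_nat q * ipoly h (z ^ k)"
      using ipoly_frobenius[OF q(1)] by blast
    ultimately have "q \<le> A"
      using A[of "(k * q) mod n" q h k] n q
      by (simp add: zmod power_mult prime_gt_0_nat)
    with q show False by simp
  qed
  have rough: "ipoly f (z ^ m) = 0" if "m > 0" "\<And>q. prime q \<Longrightarrow> q dvd m \<Longrightarrow> q > A" for m :: nat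
    using that
  proof (induction m rule: prime_divisors_induct)
    case (factor q m)
    then have "ipoly f (z ^ m) = 0"
      by (metis dvd_mult mult_is_0 neq0_conv)
    then show ?case
      using step[of q m] factor by (simp add: mult.commute)
  qed (use f in auto)
  \<comment> \<open>A prime \<open>q \<le> A\<close> divides exactly one of the two summands of \<open>m\<close>: the first one if \<open>q\<close> divides \<open>t\<close>,
    since then it divides neither \<open>n\<close> nor the product, and the second one otherwise.\<close>
  define m where "m = t + n * \<Prod>{q. prime q \<and> q \<le> A \<and> \<not> q dvd t}"
  have fin: "finite {q. prime q \<and> q \<le> A \<and> \<not> q dvd t}"
    by (rule finite_subset[of _ "{..A}"]) auto
  have "q > A" if q: "prime q" "q dvd m" for q
  proof (rule ccontr)
    assume "\<not> q > A"
    show False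
    proof (cases "q dvd t")
      case True
      then have "q dvd n * \<Prod>{q. prime q \<and> q \<le> A \<and> \<not> q dvd t}"
        using q by (simp add: m_def dvd_add_right_iff)
      moreover have "\<not> q dvd n"
        using True t q by (metis coprime_common_divisor_nat not_prime_1)
      ultimately obtain r where "prime r" "\<not> r dvd t" "q dvd r"
        using q fin by (auto simp: prime_dvd_mult_iff prime_dvd_prod_iff)
      then show False
        using True q(1) primes_dvd_imp_eq by blast
    next
      case False
      then have "q dvd \<Prod>{q. prime q \<and> q \<le> A \<and> \<not> q dvd t}"
        using q \<open>\<not> q > A\<close> by (intro dvd_prodI[OF fin]) auto
      then show False
        using False q by (auto simp: m_def dvd_add_left_iff)
    qed
  qed
  moreover have "m > 0"
    using n fin by (auto simp: m_def prod_pos prime_gt_0_nat intro!: prod_pos)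
  ultimately have "ipoly f (z ^ m) = 0"
    using rough by blast
  also have "z ^ m = z ^ t"
    using z by (simp add: m_def power_add power_mult)
  finally show ?thesis .
qed

lemma rational_poly_conjugate:
  assumes z: "z ^ n = 1" "n > 0" and f: "f \<in> polys_over \<rat>" "poly f z = 0" and t: "coprime t n"
  shows "poly f (z ^ t) = 0"
proof -
  obtain D :: nat where D: "D > 0" "\<And>i. i \<in> {..degree f} \<Longrightarrow> of_nat D * coeff f i \<in> \<int>"
    using common_denominator[of "{..degree f}" "coeff f"] f(1) by (auto simp: polys_over_def)
  have "of_nat D * coeff f i \<in> \<int>" for i
    using D(2)[of i] by (cases "i \<le> degree f") (simp_all add: coeff_eq_0)
  then have "\<forall>i. \<exists>c. of_nat D * coeff f i = of_int c"
    by (metis Ints_cases)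
  then obtain c :: "nat \<Rightarrow> int" where c: "\<And>i. of_nat D * coeff f i = of_int (c i)"
    by metis
  have "c i = 0" if "i > degree f" for i
    using c[of i] that by (simp add: coeff_eq_0)
  then have "coeff (Abs_poly c) = c"
    by (rule coeff_Abs_poly)
  then have "map_poly of_int (Abs_poly c) = Polynomial.smult (of_nat D) f"
    using c by (intro poly_eqI) (simp add: coeff_map_poly)
  then have "ipoly (Abs_poly c) w = of_nat D * poly f w" for w
    by simp
  then show ?thesis
    using ipoly_conjugate[OF z _ t, of "Abs_poly c"] f(2) D(1) by simp
qed

text \<open>
  With \<open>n = p * m\<close>, multiplication of \<open>z\<close> by a \<open>p\<close>-th root of unity is the power map with exponent
  \<open>i * m + 1\<close>.  This exponent is coprime to \<open>m\<close>, and hence to \<open>n\<close>, because \<open>p\<close> divides \<open>m\<close>.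
\<close>

lemma rational_poly_twist:
  assumes z: "primitive_root_unity (p * m) z" and "p * m > 0" "p dvd m"
    and f: "f \<in> polys_over \<rat>" "poly f z = 0"
  shows "poly f ((z ^ m) ^ i * z) = 0"
proof -
  have "coprime (i * m + 1) m"
  proof (rule coprimeI)
    fix d assume d: "d dvd i * m + 1" "d dvd m"
    then have "d dvd i * m"
      by simp
    then show "d dvd 1"
      using d(1) dvd_add_right_iff by blast
  qed
  then have "coprime (i * m + 1) (m * m)"
    by simp
  moreover have "p * m dvd m * m"
    using \<open>p dvd m\<close> by (simp add: mult_dvd_mono)
  ultimately have "coprime (i * m + 1) (p * m)"
    by (rule coprime_divisors[OF dvd_refl, rotated])
  then have "poly f (z ^ (i * m + 1)) = 0"
    by (rule rational_poly_conjugate[OF primitive_root_unity_power_eq_1[OF z] \<open>p * m > 0\<close> f])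
  moreover have "z ^ (i * m + 1) = (z ^ m) ^ i * z"
    by (simp add: mult.commute[of m] flip: power_mult)
  ultimately show ?thesis
    by metis
qed

section \<open>When the relations of a root of unity are graded\<close>

text \<open>
  A monic polynomial is the product of its linear factors.
\<close>

lemma (in complex_subfield) monic_polys_over_if_roots:
  assumes "lead_coeff f = 1" "\<And>x. poly f x = 0 \<Longrightarrow> x \<in> K"
  shows "f \<in> polys_over K"
proof -
  have prod: "prod h A \<in> polys_over K" if "\<And>x. x \<in> A \<Longrightarrow> h x \<in> polys_over K"
    for h and A :: "complex set"
    using that by (induction A rule: infinite_finite_induct) (auto intro: polys_over_mult polys_over_1)
  have "(\<Prod>x | poly f x = 0. [:- x, 1:] ^ order x f) \<in> polys_over K"
  proof (rule prod, rule polys_over_power)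
    fix x assume "x \<in> {x. poly f x = 0}"
    then show "[:- x, 1:] \<in> polys_over K"
      using assms(2) by (simp add: polys_over_pCons_iff minus_mem one_mem polys_over_0)
  qed
  moreover have "(\<Prod>x | poly f x = 0. [:- x, 1:] ^ order x f) = f"
    using complex_poly_decompose[of f] assms(1) by simp
  ultimately show ?thesis
    by simp
qed

text \<open>
  The coefficients of the minimal polynomial of \<open>z\<close> over \<open>K\<close> lie in \<open>K\<close>, and they are integral polynomials
  in the conjugates of \<open>z\<close>, which are powers of \<open>z\<close>.  By hypothesis they are thus rational expressions
  in \<open>z ^ p\<close>.  Hence the conjugation that multiplies \<open>z\<close> by a \<open>p\<close>-th root of unity fixes
  them, and it maps roots of the minimal polynomial to roots.  Fourier inversion does the rest.
  For \<open>K = \<rat>\<close> the inclusion is trivial.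
\<close>

lemma graded_relations_if_intersection:
  assumes "complex_subfield K"
    and z: "primitive_root_unity n z" and n: "n > 0" and p: "p > 0" "p * p dvd n"
    and sub: "K \<inter> adjoin \<rat> z \<subseteq> adjoin \<rat> (z ^ p)"
  shows "graded_relations K p z"
proof -
  interpret complex_subfield K by fact
  interpret Q: complex_subfield \<rat>
    by (rule complex_subfield_Rats)
  note X = root_unity_poly[OF n primitive_root_unity_power_eq_1[OF z]]
  have X_K: "monom 1 n - 1 \<in> polys_over K"
    using X(3) polys_over_mono[OF Rats_subset] by blast
  interpret L: complex_subfield "adjoin \<rat> z"
    using Q.complex_subfield_adjoin X by blast
  obtain k where "n = p * p * k"
    using p(2) by (elim dvdE)
  then obtain m where m: "n = p * m" "p dvd m"
    using that[of "p * k"] by simp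
  define w where "w = z ^ m"
  have w: "primitive_root_unity p w"
    using primitive_root_unity_power[of p m z] z n m(1) by (simp add: w_def)
  obtain \<mu> where \<mu>: "\<mu> \<in> polys_over K" "\<mu> \<noteq> 0" "poly \<mu> z = 0"
    and \<mu>_dvd: "\<And>f. f \<in> polys_over K \<Longrightarrow> poly f z = 0 \<Longrightarrow> \<exists>h\<in>polys_over K. f = h * \<mu>"
    using minimal_polynomial[OF X_K X(2,1)] by blast
  define \<nu> where "\<nu> = Polynomial.smult (inverse (lead_coeff \<mu>)) \<mu>"
  have "lead_coeff \<nu> = 1" "poly \<nu> z = 0"
    using \<mu> by (simp_all add: \<nu>_def)
  have "coeff \<nu> j \<in> K" for j
    using \<mu>(1) by (simp add: \<nu>_def polys_over_def mult_mem inverse_mem)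
  moreover have "\<nu> \<in> polys_over (adjoin \<rat> z)"
  proof (rule L.monic_polys_over_if_roots)
    fix x assume "poly \<nu> x = 0"
    then have "poly \<mu> x = 0"
      using \<mu>(2) by (simp add: \<nu>_def)
    then have "poly (monom 1 n - 1) x = 0"
      using \<mu>_dvd[OF X_K X(1)] by (metis mult_zero_right poly_mult)
    then have "x ^ n = 1"
      by (simp add: poly_monom)
    then obtain j where "x = z ^ j"
      using primitive_root_unity_generates[OF z n] by metis
    then show "x \<in> adjoin \<rat> z"
      using Q.adjoin_power[OF Q.adjoin_gen] by simp
  qed fact
  ultimately have "coeff \<nu> j \<in> adjoin \<rat> (z ^ p)" for j
    using sub by (auto simp: polys_over_def)
  then have "\<exists>r. r \<in> polys_over \<rat> \<and> coeff \<nu> j = poly r (z ^ p)" for j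
    by (auto simp: adjoin_def)
  then obtain r where r: "\<And>j. r j \<in> polys_over \<rat>" "\<And>j. coeff \<nu> j = poly (r j) (z ^ p)"
    by metis
  \<comment> \<open>The polynomial \<open>\<nu>\<close> becomes rational when its coefficients are spelt out in \<open>z ^ p\<close>,
    and \<open>z ^ p\<close> does not notice the substitution of \<open>w ^ i * z\<close> for \<open>z\<close>.\<close>
  define g where "g = (\<Sum>j\<le>degree \<nu>. monom 1 j * pcompose (r j) (monom 1 p))"
  have g: "g \<in> polys_over \<rat>"
    unfolding g_def using r(1)
    by (intro Q.polys_over_sum Q.polys_over_mult Q.polys_over_monom Q.polys_over_pcompose) auto
  have g_eq: "poly g x = poly \<nu> x" if "x ^ p = z ^ p" for x
    using that by (simp add: g_def poly_sum poly_monom poly_pcompose poly_altdef[of \<nu>] r(2) mult.commute)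
  have "poly \<mu> (w ^ i * z) = 0" for i
  proof -
    have "(w ^ i * z) ^ p = (w ^ p) ^ i * z ^ p"
      by (simp add: power_mult_distrib mult.commute flip: power_mult)
    then have "(w ^ i * z) ^ p = z ^ p"
      using primitive_root_unity_power_eq_1[OF w] by simp
    moreover have "poly g z = 0"
      using g_eq[of z] \<open>poly \<nu> z = 0\<close> by simp
    then have "poly g (w ^ i * z) = 0"
      unfolding w_def using z n m g by (intro rational_poly_twist) simp_all
    ultimately show ?thesis
      using g_eq[of "w ^ i * z"] \<mu>(2) by (simp add: \<nu>_def)
  qed
  then have "poly f (w ^ i * z) = 0" if "f \<in> polys_over K" "poly f z = 0" for f i
    using \<mu>_dvd[OF that] by auto
  then show ?thesis
    by (rule graded_relationsI[OF w p(1)])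
qed

text \<open>
  Expand \<open>x\<close> in powers of \<open>z ^ m\<close> with rational coefficients, and in powers of \<open>z ^ p\<close> with coefficients in
  \<open>K\<close>.  The second expansion is homogeneous of class \<open>0\<close>, so only the terms of class \<open>0\<close> of the first one
  contribute.  As \<open>p\<close> is prime to \<open>m\<close>, these are the powers of \<open>(z ^ m) ^ p\<close>.
\<close>

lemma graded_relations_descent:
  assumes "complex_subfield K" and graded: "graded_relations K p z"
    and p: "prime p" "\<not> p dvd m"
    and x: "x \<in> adjoin K (z ^ p)" "x \<in> adjoin \<rat> (z ^ m)"
  shows "x \<in> adjoin \<rat> ((z ^ m) ^ p)"
proof -
  interpret complex_subfield K by fact
  interpret Q: complex_subfield \<rat>
    by (rule complex_subfield_Rats)
  obtain h where h: "h \<in> polys_over K" "x = poly h (z ^ p)"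
    using x(1) by (auto simp: adjoin_def)
  obtain f where f: "f \<in> polys_over \<rat>" "x = poly f (z ^ m)"
    using x(2) by (auto simp: adjoin_def)
  have xf: "x = (\<Sum>j\<le>degree f. coeff f j * z ^ (m * j))"
    and xh: "x = (\<Sum>i\<le>degree h. coeff h i * z ^ (p * i))"
    using f(2) h(2) by (simp_all only: poly_altdef power_mult)
  define g where "g = (\<Sum>j\<le>degree f. monom (coeff f j) (m * j)) - (\<Sum>i\<le>degree h. monom (coeff h i) (p * i))"
  have "f \<in> polys_over K"
    using f(1) polys_over_mono[OF Rats_subset] by blast
  then have "g \<in> polys_over K"
    unfolding g_def using h(1)
    by (intro polys_over_diff polys_over_sum polys_over_monom) (auto simp: polys_over_def)
  moreover have "poly g z = 0"
    using xf xh by (simp add: g_def poly_sum poly_monom)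
  ultimately have "poly (part p 0 g) z = 0"
    using graded by (simp add: graded_relations_def)
  moreover have "[m * j = 0] (mod p) \<longleftrightarrow> p dvd j" for j
    using p by (simp add: cong_0_iff prime_dvd_mult_iff)
  then have "part p 0 g = (\<Sum>j\<le>degree f. if p dvd j then monom (coeff f j) (m * j) else 0) -
      (\<Sum>i\<le>degree h. monom (coeff h i) (p * i))"
    by (simp add: g_def part_diff part_sum part_monom cong_0_iff)
  ultimately have "(\<Sum>j\<le>degree f. poly (if p dvd j then monom (coeff f j) (m * j) else 0) z) = x"
    using xh by (simp add: poly_sum poly_monom)
  then have "x = (\<Sum>j\<le>degree f. if p dvd j then coeff f j * (z ^ m) ^ j else 0)"
    by (auto simp: poly_monom power_mult intro!: sum.cong)
  moreover have "coeff f j * (z ^ m) ^ j \<in> adjoin \<rat> ((z ^ m) ^ p)" if "p dvd j" for j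
  proof -
    obtain k where "j = p * k"
      using \<open>p dvd j\<close> by (elim dvdE)
    then have "(z ^ m) ^ j \<in> adjoin \<rat> ((z ^ m) ^ p)"
      using Q.adjoin_power[OF Q.adjoin_gen, of "(z ^ m) ^ p" k] by (simp only: power_mult)
    moreover have "coeff f j \<in> \<rat>"
      using f(1) by (simp add: polys_over_def)
    ultimately show ?thesis
      by (intro Q.adjoin_mult[OF Q.adjoin_base])
  qed
  ultimately show ?thesis
    using Q.adjoin_base[OF Q.zero_mem] by (auto intro!: Q.adjoin_sum)
qed

text \<open>
  If \<open>n = p * m\<close> with \<open>m\<close> prime to \<open>p\<close>, then the vanishing sum of all \<open>p\<close>-th roots of unity
  \<open>z ^ (m * i)\<close> has one term in each residue class of exponents modulo \<open>p\<close>, and it is not homogeneous.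
\<close>

lemma square_dvd_if_graded_relations:
  assumes "complex_subfield K" and graded: "graded_relations K p z"
    and z: "primitive_root_unity n z" and n: "n > 0" and p: "prime p" "p dvd n"
  shows "p * p dvd n"
proof (rule ccontr)
  interpret complex_subfield K by fact
  obtain m where m: "n = p * m"
    using p(2) by (elim dvdE)
  assume "\<not> p * p dvd n"
  then have "\<not> p dvd m"
    using m by auto
  define w where "w = z ^ m"
  have w: "primitive_root_unity p w"
    using primitive_root_unity_power[of p m z] z n m by (simp add: w_def)
  have "w ^ p = 1" "w \<noteq> 1"
    using w prime_gt_1_nat[OF p(1)] primitive_root_unity_power_eq_1[OF w]
      primitive_root_unity_def[of p w] by (auto dest: spec[of _ 1])
  define f where "f = (\<Sum>i<p. monom (1 :: complex) (m * i))"
  have "poly f z = (\<Sum>i<p. w ^ i)"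
    by (simp add: f_def w_def poly_sum poly_monom power_mult)
  then have "poly f z = 0"
    using \<open>w ^ p = 1\<close> \<open>w \<noteq> 1\<close> by (simp add: sum_gp_strict)
  moreover have "f \<in> polys_over K"
    unfolding f_def by (intro polys_over_sum polys_over_monom one_mem)
  ultimately have "poly (part p 0 f) z = 0"
    using graded by (simp add: graded_relations_def)
  moreover have "[m * i = 0] (mod p) \<longleftrightarrow> i = 0" if "i < p" for i
    using p(1) that \<open>\<not> p dvd m\<close> by (auto simp: cong_0_iff prime_dvd_mult_iff dest: dvd_imp_le)
  then have "part p 0 f = (\<Sum>i<p. if i = 0 then 1 else 0)"
    unfolding f_def part_sum part_monom by (intro sum.cong) (auto simp: monom_0 one_pCons)
  then have "part p 0 f = 1"
    using prime_gt_0_nat[OF p(1)] by simp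
  ultimately show False
    by simp
qed

text \<open>
  Put \<open>N = lcm n d\<close> and let \<open>z\<close> be a primitive root of unity of order \<open>N\<close>.  As \<open>n\<close> carries the full power of
  \<open>p\<close> in \<open>N\<close> and \<open>d\<close> does not, \<open>N / n\<close> is prime to \<open>p\<close> and \<open>N / d\<close> is divisible by \<open>p\<close>.  So elements of the
  second field are expressions in \<open>z ^ p\<close>, and the descent applies.
\<close>

lemma cyclotomic_field_Int_subset:
  assumes n: "n > 0" and d: "d > 0" and p: "prime p" "p * p dvd n"
    and less: "multiplicity p d < multiplicity p n"
  shows "cyclotomic_field n \<inter> cyclotomic_field d \<subseteq> cyclotomic_field (n div p)"
proof
  interpret Q: complex_subfield \<rat>
    by (rule complex_subfield_Rats)
  fix x assume x: "x \<in> cyclotomic_field n \<inter> cyclotomic_field d"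
  define N where "N = lcm n d"
  have N: "N > 0"
    using n d by (simp add: N_def lcm_pos_nat)
  define z where "z = cis (2 * pi / real N)"
  have z: "primitive_root_unity N z"
    using N unfolding z_def by (rule primitive_root_unity_cis)
  obtain m where m: "N = n * m"
    by (metis N_def dvd_def dvd_lcm1)
  obtain e where e: "N = d * e"
    by (metis N_def dvd_def dvd_lcm2)
  have "m > 0"
    using N m by simp
  have "e > 0"
    using N e by simp
  have "p dvd e"
  proof (rule ccontr)
    assume "\<not> p dvd e"
    then have "multiplicity p N = multiplicity p d"
      using e p(1) d \<open>e > 0\<close> by (simp add: prime_elem_multiplicity_mult_distrib not_dvd_imp_multiplicity_0)
    moreover have "multiplicity p n \<le> multiplicity p N"
      using m N by (intro dvd_imp_multiplicity_le) auto
    ultimately show False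
      using less by simp
  qed
  have "\<not> p dvd m"
  proof
    assume "p dvd m"
    then obtain m' where m': "m = p * m'"
      by (elim dvdE)
    obtain e' where e': "e = p * e'"
      using \<open>p dvd e\<close> by (elim dvdE)
    have "n * m' = d * e'"
      using m e m' e' prime_gt_0_nat[OF p(1)] by simp
    then have "N dvd n * m'"
      unfolding N_def by (intro lcm_least) (metis dvd_triv_left)+
    moreover have "n * m' < N" "n * m' > 0"
      using m m' N prime_gt_1_nat[OF p(1)] by auto
    ultimately show False
      by (meson dvd_imp_le not_le)
  qed
  have zm: "primitive_root_unity n (z ^ m)"
    using primitive_root_unity_power z m \<open>m > 0\<close> by blast
  have ze: "primitive_root_unity d (z ^ e)"
    using primitive_root_unity_power z e \<open>e > 0\<close> by blast
  have "p dvd n"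
    using p(2) dvd_mult_left by blast
  then have zmp: "primitive_root_unity (n div p) ((z ^ m) ^ p)"
    using zm prime_gt_0_nat[OF p(1)] primitive_root_unity_power[of "n div p" p "z ^ m"] by simp
  have "p * p dvd N"
    using p(2) m by auto
  then have "graded_relations \<rat> p z"
    using prime_gt_0_nat[OF p(1)]
    by (intro graded_relations_if_intersection[OF complex_subfield_Rats z N])
      (auto intro: Q.adjoin_base)
  moreover have "x \<in> adjoin \<rat> (z ^ m)"
    using x cyclotomic_field_eq_adjoin[OF zm n] by simp
  moreover have "z ^ e \<in> adjoin \<rat> (z ^ p)"
    using \<open>p dvd e\<close> Q.adjoin_power[OF Q.adjoin_gen, of "z ^ p"] by (auto simp: power_mult elim!: dvdE)
  then have "x \<in> adjoin \<rat> (z ^ p)"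
    using x cyclotomic_field_eq_adjoin[OF ze d] Q.adjoin_subset by blast
  ultimately have "x \<in> adjoin \<rat> ((z ^ m) ^ p)"
    by (intro graded_relations_descent[OF complex_subfield_Rats _ p(1) \<open>\<not> p dvd m\<close>])
  then show "x \<in> cyclotomic_field (n div p)"
    using cyclotomic_field_eq_adjoin[OF zmp] n \<open>p dvd n\<close> prime_gt_0_nat[OF p(1)]
    by (simp add: dvd_imp_le div_greater_zero_iff)
qed

lemma kappa_dvd:
  assumes "n > 0"
  shows "kappa K n dvd n"
  unfolding kappa_def using assms by (intro Gcd_dvd) auto

text \<open>
  If the full power of \<open>p\<close> in \<open>n\<close> does not divide the greatest common divisor, then it does not divide
  some admissible \<open>d\<close>, and \<^term>\<open>cyclotomic_field n \<inter> cyclotomic_field d\<close> is small enough.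
  Conversely the inclusion makes \<open>n div p\<close> itself admissible.
\<close>

lemma multiplicity_kappa_less_iff:
  assumes n: "n > 0" and p: "prime p" "p * p dvd n"
  shows "multiplicity p (kappa K n) < multiplicity p n \<longleftrightarrow>
    K \<inter> cyclotomic_field n \<subseteq> cyclotomic_field (n div p)"
proof -
  have "p dvd n"
    using p(2) dvd_mult_left by blast
  then obtain m where m: "n = p * m"
    by (elim dvdE)
  have "m > 0"
    using n m by simp
  have kappa0: "kappa K n > 0"
    using n kappa_dvd[OF n, of K] by (rule dvd_pos_nat)
  show ?thesis
  proof
    assume less: "multiplicity p (kappa K n) < multiplicity p n"
    have "\<exists>d\<ge>1. K \<inter> cyclotomic_field n \<subseteq> cyclotomic_field d \<and> multiplicity p d < multiplicity p n"
    proof (rule ccontr)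
      assume *: "\<not> ?thesis"
      have "p ^ multiplicity p n dvd kappa K n"
        unfolding kappa_def
      proof (rule Gcd_greatest)
        fix d assume "d \<in> {d. d \<ge> 1 \<and> K \<inter> cyclotomic_field n \<subseteq> cyclotomic_field d}"
        with * have "multiplicity p n \<le> multiplicity p d"
          using not_less by blast
        then show "p ^ multiplicity p n dvd d"
          by (rule multiplicity_dvd')
      qed
      then have "multiplicity p n \<le> multiplicity p (kappa K n)"
        using p(1) kappa0 by (intro multiplicity_geI) auto
      with less show False by simp
    qed
    then obtain d where d: "d \<ge> 1" "K \<inter> cyclotomic_field n \<subseteq> cyclotomic_field d"
      "multiplicity p d < multiplicity p n"
      by blast
    have "d > 0"
      using d(1) by simp
    show "K \<inter> cyclotomic_field n \<subseteq> cyclotomic_field (n div p)"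
      using cyclotomic_field_Int_subset[OF n \<open>d > 0\<close> p d(3)] d(2) by blast
  next
    assume *: "K \<inter> cyclotomic_field n \<subseteq> cyclotomic_field (n div p)"
    have "n div p = m"
      using m prime_gt_0_nat[OF p(1)] by simp
    with * have "kappa K n dvd m"
      unfolding kappa_def using \<open>m > 0\<close> by (intro Gcd_dvd) auto
    then have "multiplicity p (kappa K n) \<le> multiplicity p m"
      using \<open>m > 0\<close> by (intro dvd_imp_multiplicity_le) auto
    also have "\<dots> < multiplicity p n"
      using m \<open>m > 0\<close> p(1) by (simp add: prime_elem_multiplicity_mult_distrib prime_gt_0_nat)
    finally show "multiplicity p (kappa K n) < multiplicity p n" .
  qed
qed

text \<open>
  In the forward direction an element of \<open>K\<close> is a polynomial of degree \<open>0\<close> in \<open>z ^ p\<close>, so the descent with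
  \<open>m = 1\<close> applies to it.
\<close>

lemma graded_relations_iff_kappa:
  assumes "complex_subfield K"
    and z: "primitive_root_unity n z" and n: "n > 0" and p: "prime p" "p dvd n"
  shows "graded_relations K p z \<longleftrightarrow>
    p * p dvd n \<and> multiplicity p (kappa K n) < multiplicity p n"
proof -
  interpret complex_subfield K by fact
  have p0: "p > 0"
    using p(1) by (rule prime_gt_0_nat)
  have "primitive_root_unity (n div p) (z ^ p)"
    using z p p0 primitive_root_unity_power[of "n div p" p z] by simp
  then have fields: "cyclotomic_field n = adjoin \<rat> z" "cyclotomic_field (n div p) = adjoin \<rat> (z ^ p)"
    using z n p p0 by (auto intro!: cyclotomic_field_eq_adjoin simp: dvd_imp_le div_greater_zero_iff)
  have "K \<inter> adjoin \<rat> z \<subseteq> adjoin \<rat> (z ^ p)" if "graded_relations K p z"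
    using graded_relations_descent[OF assms(1) that p(1), of 1] prime_gt_1_nat[OF p(1)]
    by (auto intro: adjoin_base)
  then show ?thesis
    using graded_relations_if_intersection[OF assms(1) z n p0]
      square_dvd_if_graded_relations[OF assms(1) _ z n p]
      multiplicity_kappa_less_iff[OF n p(1), of K] fields by auto
qed

text \<open>
  At primes that do not divide \<open>a\<close> the supernatural number allows the exponent \<open>1\<close>.  So a failure of
  divisibility at \<open>p\<close> requires an exponent of at least \<open>2\<close>.
\<close>

lemma supernatural_dvd_hat_iff:
  assumes "n > 0" "a > 0"
  shows "supernatural_dvd (supernatural_of_nat n) (hat a) \<longleftrightarrow>
    (\<forall>p. prime p \<longrightarrow> \<not> (p * p dvd n \<and> multiplicity p a < multiplicity p n))"
proof -
  have "enat (multiplicity p n) \<le> hat a p \<longleftrightarrow> \<not> (p * p dvd n \<and> multiplicity p a < multiplicity p n)"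
    if p: "prime p" for p
  proof -
    have "p \<noteq> 1"
      using p not_prime_1 by blast
    then have sq: "p * p dvd n \<longleftrightarrow> 2 \<le> multiplicity p n"
      using power_dvd_iff_le_multiplicity[of n p 2] assms by (simp add: power2_eq_square)
    have "p dvd a \<longleftrightarrow> multiplicity p a \<ge> 1"
      using power_dvd_iff_le_multiplicity[of a p 1] assms \<open>p \<noteq> 1\<close> by simp
    moreover have "hat a p = enat (multiplicity p a + (if p dvd a then 0 else 1))"
      using p by (simp add: hat_def supernatural_mult_def supernatural_of_nat_def prod_primes_def
          one_enat_def zero_enat_def)
    ultimately show ?thesis
      using sq by auto
  qed
  then show ?thesis
    by (simp add: supernatural_dvd_def supernatural_of_nat_def)
qed

section \<open>Irreducible representations of a cyclic group\<close>

text \<open>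
  A subspace is invariant under a cyclic group if and only if it is invariant under a generator, hence
  the irreducibility of a single endomorphism \<open>g\<close>.
\<close>

locale irreducible_endomorphism =
  complex_subfield K + vectorspace "field_of K" V
  for K :: "complex set" and V :: "(complex, 'v, 'm) module_scheme" (structure) +
  fixes g :: "'v \<Rightarrow> 'v"
  assumes hom: "g \<in> module_hom (field_of K) V V"
    and irreducible: "\<And>W. VectorSpace.subspace (field_of K) W V \<Longrightarrow> g ` W \<subseteq> W \<Longrightarrow>
      W = {\<zero>} \<or> W = carrier V"
begin

lemma smult_closed': "a \<in> K \<Longrightarrow> x \<in> carrier V \<Longrightarrow> a \<odot> x \<in> carrier V"
  using smult_closed[of a x] by simp

lemma smult_add: "a \<in> K \<Longrightarrow> b \<in> K \<Longrightarrow> x \<in> carrier V \<Longrightarrow> (a + b) \<odot> x = a \<odot> x \<oplus> b \<odot> x"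
  using smult_l_distr[of a b x] by simp

lemma smult_mult: "a \<in> K \<Longrightarrow> b \<in> K \<Longrightarrow> x \<in> carrier V \<Longrightarrow> (a * b) \<odot> x = a \<odot> (b \<odot> x)"
  using smult_assoc1[of a b x] by simp

lemma smult_one': "x \<in> carrier V \<Longrightarrow> 1 \<odot> x = x"
  using smult_one[of x] by simp

lemma smult_zero: "x \<in> carrier V \<Longrightarrow> 0 \<odot> x = \<zero>"
  using lmult_0[of x] by simp

lemma smult_zero_right: "a \<in> K \<Longrightarrow> a \<odot> \<zero> = \<zero>"
  using rmult_0[of a] by simp

lemma g_closed: "x \<in> carrier V \<Longrightarrow> g x \<in> carrier V"
  using hom by (auto simp: module_hom_def)

lemma g_add: "x \<in> carrier V \<Longrightarrow> y \<in> carrier V \<Longrightarrow> g (x \<oplus> y) = g x \<oplus> g y"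
  using hom by (auto simp: module_hom_def)

lemma g_smult: "a \<in> K \<Longrightarrow> x \<in> carrier V \<Longrightarrow> g (a \<odot> x) = a \<odot> g x"
  using hom by (auto simp: module_hom_def)

lemma g_zero: "g \<zero> = \<zero>"
  using g_smult[of 0 "\<zero>"] smult_zero[of "\<zero>"] smult_zero[OF g_closed, of "\<zero>"] by (simp add: zero_mem)

text \<open>
  The value \<open>f(g) x\<close>, by Horner's scheme.
\<close>

definition act :: "complex poly \<Rightarrow> 'v \<Rightarrow> 'v" where
  "act f x = fold_coeffs (\<lambda>a y. a \<odot> x \<oplus> g y) f \<zero>"

lemma act_0: "act 0 x = \<zero>"
  by (simp add: act_def)

lemma act_pCons: "x \<in> carrier V \<Longrightarrow> act (pCons a f) x = a \<odot> x \<oplus> g (act f x)"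
  by (cases "a = 0 \<and> f = 0") (auto simp: act_def smult_zero g_zero)

lemma act_closed: "f \<in> polys_over K \<Longrightarrow> x \<in> carrier V \<Longrightarrow> act f x \<in> carrier V"
  by (induction f) (auto simp: act_0 act_pCons polys_over_pCons_iff smult_closed' g_closed)

lemma act_const: "x \<in> carrier V \<Longrightarrow> a \<in> K \<Longrightarrow> act [:a:] x = a \<odot> x"
  by (simp add: act_pCons act_0 g_zero smult_closed')

lemma act_1: "x \<in> carrier V \<Longrightarrow> act 1 x = x"
  using act_const[of x 1] by (simp add: one_pCons smult_one' one_mem)

lemma act_X: "f \<in> polys_over K \<Longrightarrow> x \<in> carrier V \<Longrightarrow> act (pCons 0 f) x = g (act f x)"
  by (simp add: act_pCons smult_zero g_closed act_closed)

lemma act_add: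
  assumes "f \<in> polys_over K" "h \<in> polys_over K" "x \<in> carrier V"
  shows "act (f + h) x = act f x \<oplus> act h x"
  using assms
proof (induction f h rule: poly_induct2)
  case (pCons a f b h)
  then show ?case
    by (simp add: act_pCons polys_over_pCons_iff smult_add g_add act_closed smult_closed' g_closed
        M.add.m_ac)
qed (simp add: act_0)

lemma act_smult:
  assumes "c \<in> K" "f \<in> polys_over K" "x \<in> carrier V"
  shows "act (Polynomial.smult c f) x = c \<odot> act f x"
  using assms(2)
proof (induction f)
  case (pCons a f)
  then show ?case
    using assms
    by (simp add: act_pCons polys_over_pCons_iff smult_mult g_smult act_closed smult_closed' g_closed
        smult_r_distr)
qed (simp add: act_0 smult_zero_right assms)

lemma act_mult:
  assumes "f \<in> polys_over K" "h \<in> polys_over K" "x \<in> carrier V"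
  shows "act (f * h) x = act f (act h x)"
  using assms(1)
proof (induction f)
  case (pCons a f)
  then have "f * h \<in> polys_over K"
    by (simp add: polys_over_pCons_iff polys_over_mult assms)
  then show ?case
    using pCons assms
    by (simp add: act_add act_smult act_X polys_over_pCons_iff polys_over_smult zero_mem act_pCons act_closed
        smult_zero g_closed)
qed (simp add: act_0)

lemma act_monom: "x \<in> carrier V \<Longrightarrow> act (monom 1 j) x = (g ^^ j) x"
proof (induction j)
  case 0
  then show ?case
    using act_1[of x] by (simp add: monom_0 one_pCons)
next
  case (Suc j)
  then show ?case
    by (simp add: monom_Suc act_X polys_over_monom one_mem)
qed

text \<open>
  The image of an ideal is an invariant subspace.
\<close>

lemma subspace_act:
  assumes J: "J \<subseteq> polys_over K" "0 \<in> J" "\<And>f h. f \<in> J \<Longrightarrow> h \<in> J \<Longrightarrow> f + h \<in> J"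
    "\<And>c f. c \<in> polys_over K \<Longrightarrow> f \<in> J \<Longrightarrow> c * f \<in> J"
    and v: "v \<in> carrier V"
  shows "(\<lambda>f. act f v) ` J = {\<zero>} \<or> (\<lambda>f. act f v) ` J = carrier V"
proof (rule irreducible)
  show "VectorSpace.subspace (field_of K) ((\<lambda>f. act f v) ` J) V"
  proof (intro subspace.intro vectorspace_axioms submodule.intro)
    show "module (field_of K) V"
      by (rule module_axioms)
    show "(\<lambda>f. act f v) ` J \<subseteq> carrier V"
      using J(1) v act_closed by auto
    show "x \<oplus> y \<in> (\<lambda>f. act f v) ` J" if xy: "x \<in> (\<lambda>f. act f v) ` J" "y \<in> (\<lambda>f. act f v) ` J" for x y
    proof -
      obtain f h where "f \<in> J" "h \<in> J" "x = act f v" "y = act h v"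
        using xy by auto
      moreover from this have "act (f + h) v = act f v \<oplus> act h v"
        using J(1) v by (intro act_add) auto
      ultimately show ?thesis
        using J(3)[of f h] by (metis image_eqI)
    qed
    show "\<zero> \<in> (\<lambda>f. act f v) ` J"
      using J(2) by (intro image_eqI[of _ _ 0]) (simp_all add: act_0)
    show "c \<odot> x \<in> (\<lambda>f. act f v) ` J"
      if cx: "c \<in> carrier (field_of K)" "x \<in> (\<lambda>f. act f v) ` J" for c x
    proof -
      obtain f where f: "f \<in> J" "x = act f v"
        using cx by auto
      moreover have "c \<in> K"
        using cx by simp
      moreover from calculation have "act (Polynomial.smult c f) v = c \<odot> act f v"
        using J(1) v by (intro act_smult) auto
      ultimately show ?thesis
        using J(4)[of "[:c:]" f] by (simp add: polys_over_const image_iff) metis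
    qed
  qed
  have "g (act f v) \<in> (\<lambda>f. act f v) ` J" if "f \<in> J" for f
  proof -
    have "[:0, 1:] \<in> polys_over K"
      by (simp add: polys_over_pCons_iff zero_mem one_mem polys_over_0)
    then have "pCons 0 f \<in> J"
      using J(4)[of "[:0, 1:]" f] that by simp
    then show ?thesis
      using J(1) that v by (intro image_eqI[of _ _ "pCons 0 f"]) (simp_all add: act_X subset_iff)
  qed
  then show "g ` (\<lambda>f. act f v) ` J \<subseteq> (\<lambda>f. act f v) ` J"
    by auto
qed

lemma act_generates:
  assumes v: "v \<in> carrier V" "v \<noteq> \<zero>"
  shows "(\<lambda>f. act f v) ` polys_over K = carrier V"
proof -
  have "act 1 v \<in> (\<lambda>f. act f v) ` polys_over K"
    by (rule imageI) (rule polys_over_1)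
  then have "(\<lambda>f. act f v) ` polys_over K \<noteq> {\<zero>}"
    using v act_1[OF v(1)] by auto
  then show ?thesis
    using subspace_act[of "polys_over K" v] v(1)
    by (simp add: polys_over_0 polys_over_add polys_over_mult)
qed

lemma act_diff_eq_0:
  assumes "f \<in> polys_over K" "h \<in> polys_over K" "x \<in> carrier V"
  shows "act (f - h) x = \<zero> \<longleftrightarrow> act f x = act h x"
proof -
  have "act f x = act (f - h) x \<oplus> act h x"
    using act_add[of "f - h" h x] assms by (simp add: polys_over_diff)
  then show ?thesis
    using M.add.r_cancel_one[of "act h x" "act (f - h) x"] assms
    by (simp add: act_closed polys_over_diff)
qed

text \<open>
  The annihilator of \<open>v\<close> is generated by some \<open>\<mu>\<close>, which is not constant and so has a complex root \<open>z\<close>;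
  everything that annihilates \<open>v\<close> vanishes at \<open>z\<close>.  Conversely the ideal of polynomials vanishing at \<open>z\<close>
  maps \<open>v\<close> to an invariant subspace.  If this were the whole space, then \<open>v = h(g) v\<close> with \<open>h(z) = 0\<close>, so
  \<open>1 - h\<close> would annihilate \<open>v\<close> without vanishing at \<open>z\<close>.
\<close>

lemma eigenvalue_exists:
  assumes v: "v \<in> carrier V" "v \<noteq> \<zero>"
    and f0: "f0 \<in> polys_over K" "f0 \<noteq> 0" "act f0 v = \<zero>"
  obtains z where "\<And>f. f \<in> polys_over K \<Longrightarrow> act f v = \<zero> \<longleftrightarrow> poly f z = 0"
proof -
  define I where "I = {f \<in> polys_over K. act f v = \<zero>}"
  obtain \<mu> where \<mu>: "\<mu> \<in> I" "\<mu> \<noteq> 0" "\<And>f. f \<in> I \<Longrightarrow> \<exists>h\<in>polys_over K. f = h * \<mu>"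
  proof (rule ideal_generator[of I f0])
    show "f - h \<in> I" if "f \<in> I" "h \<in> I" for f h
      using that v(1) by (simp add: I_def polys_over_diff act_diff_eq_0)
    show "h * f \<in> I" if "f \<in> I" "h \<in> polys_over K" for f h
    proof -
      have "act h \<zero> = \<zero>"
        using that(2) by (induction h)
          (auto simp: act_0 act_pCons polys_over_pCons_iff smult_zero_right g_zero)
      then show ?thesis
        using that v by (simp add: I_def polys_over_mult act_mult)
    qed
  qed (use f0 in \<open>auto simp: I_def\<close>)
  have "\<exists>z. poly \<mu> z = 0"
  proof (rule ccontr)
    assume "\<not> ?thesis"
    then obtain c where c: "\<mu> = [:c:]"
      using fundamental_theorem_of_algebra_alt[of \<mu>] by auto
    then have "c \<in> K" "c \<noteq> 0" "c \<odot> v = \<zero>"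
      using \<mu>(1,2) v by (auto simp: I_def polys_over_pCons_iff act_const)
    then have "inverse c \<odot> (c \<odot> v) = \<zero>"
      by (simp add: smult_zero_right inverse_mem)
    moreover have "inverse c \<odot> (c \<odot> v) = v"
      using smult_mult[of "inverse c" c v] \<open>c \<in> K\<close> \<open>c \<noteq> 0\<close> v by (simp add: inverse_mem smult_one')
    ultimately show False
      using v by simp
  qed
  then obtain z where z: "poly \<mu> z = 0" ..
  have zero: "poly f z = 0" if "f \<in> polys_over K" "act f v = \<zero>" for f
    using \<mu>(3)[of f] that z by (auto simp: I_def)
  define J where "J = {f \<in> polys_over K. poly f z = 0}"
  have "(\<lambda>f. act f v) ` J = {\<zero>} \<or> (\<lambda>f. act f v) ` J = carrier V"
    using v by (intro subspace_act) (auto simp: J_def polys_over_0 polys_over_add polys_over_mult)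
  moreover have "(\<lambda>f. act f v) ` J \<noteq> carrier V"
  proof
    assume "(\<lambda>f. act f v) ` J = carrier V"
    with v(1) have "v \<in> (\<lambda>f. act f v) ` J"
      by (simp only:)
    then obtain h where "v = act h v" "h \<in> J"
      by (rule imageE)
    then have h: "h \<in> polys_over K" "poly h z = 0" "act 1 v = act h v"
      unfolding J_def act_1[OF v(1)] by blast+
    then have "act (1 - h) v = \<zero>"
      using act_diff_eq_0[OF polys_over_1 h(1) v(1)] by blast
    then have "poly (1 - h) z = 0"
      using h by (intro zero polys_over_diff polys_over_1)
    then show False
      using h by simp
  qed
  ultimately have "act f v = \<zero>" if "f \<in> polys_over K" "poly f z = 0" for f
    using that unfolding J_def by blast
  with zero show thesis
    by (intro that) blast
qed

end

text \<open>
  An identification of \<open>V\<close> with \<^term>\<open>adjoin K z\<close>.  It transports questions about sums of subspaces to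
  identities between complex numbers.
\<close>

locale coordinates =
  complex_subfield K + vectorspace "field_of K" V
  for K :: "complex set" and V :: "(complex, 'v, 'm) module_scheme" (structure) +
  fixes \<phi> :: "'v \<Rightarrow> complex" and z :: complex
  assumes bij: "bij_betw \<phi> (carrier V) (adjoin K z)"
    and add: "x \<in> carrier V \<Longrightarrow> y \<in> carrier V \<Longrightarrow> \<phi> (x \<oplus> y) = \<phi> x + \<phi> y"
    and smult: "c \<in> K \<Longrightarrow> x \<in> carrier V \<Longrightarrow> \<phi> (c \<odot> x) = c * \<phi> x"

text \<open>
  The identification maps \<open>f(g) v\<close> to \<open>f(z)\<close> for a fixed nonzero vector \<open>v\<close> and an eigenvalue \<open>z\<close>.  It turns \<open>g\<close>
  into multiplication by \<open>z\<close>, and therefore \<open>z\<close> has the same order as \<open>g\<close>.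
\<close>

lemma (in irreducible_endomorphism) coordinates_exist:
  assumes n: "n > 0" and order: "\<And>j. (\<forall>x\<in>carrier V. (g ^^ j) x = x) \<longleftrightarrow> n dvd j"
    and nontrivial: "carrier V \<noteq> {\<zero>}"
  obtains \<phi> z where "primitive_root_unity n z" "coordinates K V \<phi> z"
    "\<forall>x\<in>carrier V. \<phi> (g x) = z * \<phi> x"
proof -
  obtain v where v: "v \<in> carrier V" "v \<noteq> \<zero>"
    using nontrivial M.zero_closed by blast
  have m1: "monom 1 j \<in> polys_over K" for j
    by (intro polys_over_monom one_mem)
  have pow: "act (monom 1 j - 1) v = \<zero> \<longleftrightarrow> (g ^^ j) v = v" for j
    using v by (simp add: act_diff_eq_0 m1 polys_over_1 act_monom act_1)
  have "monom 1 n - 1 \<noteq> (0 :: complex poly)"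
    using root_unity_poly(2)[OF n, of 1] by simp
  moreover have "act (monom 1 n - 1) v = \<zero>"
    using order[of n] v pow by simp
  ultimately obtain z where z: "\<And>f. f \<in> polys_over K \<Longrightarrow> act f v = \<zero> \<longleftrightarrow> poly f z = 0"
    using eigenvalue_exists[OF v, of "monom 1 n - 1"] by (metis m1 polys_over_1 polys_over_diff)
  have eq: "act f v = act h v \<longleftrightarrow> poly f z = poly h z" if "f \<in> polys_over K" "h \<in> polys_over K" for f h
    using z[OF polys_over_diff[OF that]] act_diff_eq_0[OF that v(1)] by simp
  define \<phi> where "\<phi> x = poly (SOME f. f \<in> polys_over K \<and> x = act f v) z" for x
  have \<phi>: "\<phi> (act f v) = poly f z" if "f \<in> polys_over K" for f
  proof -
    have "(SOME h. h \<in> polys_over K \<and> act f v = act h v) \<in> polys_over K \<and>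
        act f v = act (SOME h. h \<in> polys_over K \<and> act f v = act h v) v"
      by (rule someI[of _ f]) (use that in simp)
    then show ?thesis
      unfolding \<phi>_def using eq that by metis
  qed
  have rep: "\<exists>f\<in>polys_over K. x = act f v" if "x \<in> carrier V" for x
    using that act_generates[OF v] by blast
  have g: "\<phi> (g x) = z * \<phi> x" if "x \<in> carrier V" for x
    using rep[OF that] \<phi>[of "pCons 0 f" for f] \<phi> v
    by (auto simp: polys_over_pCons_iff zero_mem simp flip: act_X)
  have inj: "inj_on \<phi> (carrier V)"
  proof (rule inj_onI)
    fix x y assume xy: "x \<in> carrier V" "y \<in> carrier V" "\<phi> x = \<phi> y"
    obtain f h where "f \<in> polys_over K" "x = act f v" "h \<in> polys_over K" "y = act h v"
      using rep xy by metis
    then show "x = y"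
      using eq[of f h] \<phi> xy by simp
  qed
  have "\<phi> ` carrier V = adjoin K z"
    unfolding act_generates[OF v, symmetric] adjoin_def image_image by (intro image_cong) (simp_all add: \<phi>)
  with inj have bij: "bij_betw \<phi> (carrier V) (adjoin K z)"
    by (simp add: bij_betw_def)
  have add: "\<phi> (x \<oplus> y) = \<phi> x + \<phi> y" if xy: "x \<in> carrier V" "y \<in> carrier V" for x y
  proof -
    obtain f h where fh: "f \<in> polys_over K" "x = act f v" "h \<in> polys_over K" "y = act h v"
      using rep xy by metis
    then show ?thesis
      using \<phi>[OF polys_over_add[OF fh(1,3)]] \<phi> v by (simp add: act_add)
  qed
  have smult: "\<phi> (c \<odot> x) = c * \<phi> x" if cx: "c \<in> K" "x \<in> carrier V" for c x
  proof -
    obtain f where f: "f \<in> polys_over K" "x = act f v"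
      using rep cx by metis
    then show ?thesis
      using \<phi>[OF polys_over_smult[OF cx(1) f(1)]] \<phi> v cx by (simp add: act_smult)
  qed
  have coord: "coordinates K V \<phi> z"
    by (intro coordinates.intro coordinates_axioms.intro complex_subfield_axioms vectorspace_axioms
        bij add smult)
  have "primitive_root_unity n z"
    unfolding primitive_root_unity_def
  proof
    fix j
    have closed: "(g ^^ j) x \<in> carrier V" if "x \<in> carrier V" for x
      using that by (induction j) (auto intro: g_closed)
    have "\<phi> ((g ^^ j) x) = z ^ j * \<phi> x" if "x \<in> carrier V" for x
    proof (induction j)
      case (Suc j)
      have "(g ^^ j) x \<in> carrier V"
        using that by (induction j) (auto intro: g_closed)
      then show ?case
        using Suc g by simp
    qed simp
    then have "(\<forall>x\<in>carrier V. (g ^^ j) x = x)" if "z ^ j = 1"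
      using that inj_onD[OF inj] closed by simp
    moreover have "z ^ j = 1" if "(g ^^ j) v = v"
      using that pow[of j] z[of "monom 1 j - 1"] by (simp add: polys_over_diff m1 polys_over_1 poly_monom)
    ultimately show "z ^ j = 1 \<longleftrightarrow> n dvd j"
      using order[of j] v by blast
  qed
  then show thesis
    using that[of z \<phi>] coord g by blast
qed

section \<open>Blocks of imprimitivity in coordinates\<close>

lemma least_power_cong:
  assumes "permutation \<pi>" "(\<pi> ^^ i) x = (\<pi> ^^ j) x"
  shows "[i = j] (mod least_power \<pi> x)"
proof -
  have *: "[i = j] (mod least_power \<pi> x)" if "i \<le> j" "(\<pi> ^^ i) x = (\<pi> ^^ j) x" for i j
  proof -
    have "(\<pi> ^^ i) ((\<pi> ^^ (j - i)) x) = (\<pi> ^^ i) x"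
      using that by (metis funpow_add le_add_diff_inverse o_apply)
    then have "(\<pi> ^^ (j - i)) x = x"
      using permutation_bijective[OF assms(1)] by (metis bij_fn bij_is_inj injD)
    then have "least_power \<pi> x dvd j - i"
      using assms(1) by (simp add: least_power_dvd)
    then show ?thesis
      using that(1) by (metis cong_altdef_nat cong_sym)
  qed
  show ?thesis
    using *[of i j] *[of j i] assms(2) by (metis cong_sym nle_le)
qed

context complex_subfield
begin

definition independent_family :: "nat \<Rightarrow> (nat \<Rightarrow> complex set) \<Rightarrow> bool" where
  "independent_family r W \<longleftrightarrow>
     (\<forall>w. (\<forall>i<r. w i \<in> W i) \<longrightarrow> (\<Sum>i<r. w i) = 0 \<longrightarrow> (\<forall>i<r. w i = 0))"

lemma independent_familyD:
  "independent_family r W \<Longrightarrow> (\<And>i. i < r \<Longrightarrow> w i \<in> W i) \<Longrightarrow> (\<Sum>i<r. w i) = 0 \<Longrightarrow> i < r \<Longrightarrow> w i = 0"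
  by (simp add: independent_family_def)

lemma independent_family_disjoint:
  assumes "independent_family r W" and W: "\<And>i. i < r \<Longrightarrow> 0 \<in> W i" "\<And>i x. i < r \<Longrightarrow> x \<in> W i \<Longrightarrow> - x \<in> W i"
    and x: "x \<in> W i" "x \<in> W j" and ij: "i < r" "j < r" "i \<noteq> j"
  shows "x = 0"
proof -
  define w where "w k = (if k = i then x else 0) + (if k = j then - x else 0)" for k
  have "\<forall>k<r. w k \<in> W k"
    using W x ij by (auto simp: w_def)
  moreover have "(\<Sum>k<r. w k) = 0"
    using ij by (simp add: w_def sum.distrib)
  ultimately have "w i = 0"
    using assms(1) ij(1) by (simp add: independent_family_def)
  then show ?thesis
    using ij by (simp add: w_def)
qed

text \<open>
  The block of \<open>z ^ j * u\<close> depends on \<open>j\<close> modulo the length \<open>m\<close> of the orbit of the block of \<open>u\<close>, and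
  different classes modulo \<open>m\<close> give different blocks.  Since \<open>z ^ n = 1\<close>, \<open>m\<close> divides \<open>n\<close>; let \<open>p\<close> be a prime
  divisor of \<open>m\<close>.  In a relation \<open>f(z) * u = 0\<close> the terms belonging to one block cancel.  Each class of
  exponents modulo \<open>p\<close> is a union of classes modulo \<open>m\<close>, so its terms cancel as well.
\<close>

lemma graded_relations_if_blocks:
  assumes ind: "independent_family r W"
    and W0: "\<And>i. i < r \<Longrightarrow> 0 \<in> W i"
    and W_add: "\<And>i x y. i < r \<Longrightarrow> x \<in> W i \<Longrightarrow> y \<in> W i \<Longrightarrow> x + y \<in> W i"
    and W_smult: "\<And>i c x. i < r \<Longrightarrow> c \<in> K \<Longrightarrow> x \<in> W i \<Longrightarrow> c * x \<in> W i"
    and \<pi>: "\<pi> permutes {..<r}" "\<And>i x. i < r \<Longrightarrow> x \<in> W i \<Longrightarrow> z * x \<in> W (\<pi> i)"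
    and u: "i0 < r" "u \<in> W i0" "u \<noteq> 0" "\<pi> i0 \<noteq> i0"
    and z: "z ^ n = 1"
  obtains p where "prime p" "p dvd n" "graded_relations K p z"
proof -
  have perm: "permutation \<pi>"
    using \<pi>(1) by (auto simp: permutation_permutes)
  define b where "b j = (\<pi> ^^ j) i0" for j
  have b_less: "b j < r" for j
    using u(1) permutes_in_image[OF \<pi>(1)] by (induction j) (auto simp: b_def)
  have zu: "z ^ j * u \<in> W (b j)" for j
  proof (induction j)
    case (Suc j)
    then show ?case
      using \<pi>(2)[OF b_less Suc] by (simp add: b_def mult.assoc)
  qed (simp add: b_def u)
  have W_neg: "- x \<in> W i" if "i < r" "x \<in> W i" for i x
    using W_smult[OF that(1) minus_mem[OF one_mem] that(2)] by simp
  have "b n = i0"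
    using independent_family_disjoint[OF ind W0 W_neg, of u "b n" i0] zu[of n] u b_less z by auto
  define m where "m = least_power \<pi> i0"
  have "m dvd n"
    using \<open>b n = i0\<close> perm by (simp add: m_def b_def least_power_dvd)
  have "m \<noteq> 1"
    using u(4) least_power_dvd[OF perm, of i0 1] by (auto simp: m_def)
  then obtain p where p: "prime p" "p dvd m"
    using prime_factor_nat by blast
  have b_cong: "[i = j] (mod p)" if "b i = b j" for i j
    using least_power_cong[OF perm, of i i0 j] that p(2)
    unfolding b_def m_def by (metis cong_dvd_modulus_nat)
  have "poly (part p a f) z = 0" if f: "f \<in> polys_over K" "poly f z = 0" for f a
  proof -
    define h where "h j = coeff f j * (z ^ j * u)" for j
    have sum_W: "sum h A \<in> W i" if "i < r" "\<And>j. j \<in> A \<Longrightarrow> b j = i" for A i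
      using that
    proof (induction A rule: infinite_finite_induct)
      case (insert j A)
      have "h j \<in> W i"
        using W_smult[OF insert.prems(1), of "coeff f j" "z ^ j * u"] insert.prems(2)[of j] f(1) zu[of j]
        by (simp add: h_def polys_over_def)
      then show ?case
        using insert by (simp add: W_add)
    qed (use W0 in auto)
    define w where "w i = sum h {j \<in> {..degree f}. b j = i}" for i
    have "(\<Sum>i<r. w i) = sum h {..degree f}"
      unfolding w_def using b_less by (intro sum.group) auto
    also have "\<dots> = poly f z * u"
      by (simp add: h_def poly_altdef sum_distrib_right mult.assoc)
    finally have "(\<Sum>i<r. w i) = 0"
      using f by simp
    moreover have "\<forall>i<r. w i \<in> W i"
      unfolding w_def by (intro allI impI sum_W) simp_all
    ultimately have w0: "w i = 0" if "i < r" for i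
      using ind that by (simp add: independent_family_def)
    define S where "S = {j \<in> {..degree f}. [j = a] (mod p)}"
    have fibre: "sum h {j \<in> S. b j = i} = 0" if "i < r" for i
    proof (cases "{j \<in> S. b j = i} = {}")
      case True
      then show ?thesis
        by (simp only: sum.empty)
    next
      case False
      then obtain k where "k \<in> S" "b k = i"
        by blast
      then have "{j \<in> S. b j = i} = {j \<in> {..degree f}. b j = i}"
        using b_cong by (auto simp: S_def intro: cong_trans)
      then show ?thesis
        using w0[OF that] by (simp add: w_def)
    qed
    have "sum h S = (\<Sum>i<r. sum h {j \<in> S. b j = i})"
      using b_less by (intro sum.group[symmetric]) (auto simp: S_def)
    with fibre have "sum h S = 0"
      by simp
    have "poly (part p a f) z * u = (\<Sum>j\<le>degree f. if [j = a] (mod p) then h j else 0)"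
      unfolding poly_part sum_distrib_right by (intro sum.cong) (auto simp: h_def mult.assoc)
    also have "\<dots> = sum h S"
      unfolding S_def by (rule sum.inter_filter[symmetric]) simp
    finally show ?thesis
      using \<open>sum h S = 0\<close> u(3) by simp
  qed
  then have "graded_relations K p z"
    by (simp add: graded_relations_def)
  then show thesis
    using that p dvd_trans[OF p(2) \<open>m dvd n\<close>] by blast
qed

text \<open>
  The span over \<open>K\<close> of the powers of \<open>z\<close> whose exponents are congruent to \<open>a\<close>.
\<close>

definition homogeneous :: "nat \<Rightarrow> complex \<Rightarrow> nat \<Rightarrow> complex set" where
  "homogeneous p z a = {poly f z | f. f \<in> polys_over K \<and> part p a f = f}"

lemma homogeneous_cong: "[a = b] (mod p) \<Longrightarrow> homogeneous p z a = homogeneous p z b"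
  by (simp add: homogeneous_def part_cong)

lemma homogeneous_part: "f \<in> polys_over K \<Longrightarrow> poly (part p a f) z \<in> homogeneous p z a"
  unfolding homogeneous_def by (auto intro!: exI[of _ "part p a f"] simp: polys_over_part part_part)

lemma homogeneous_subset: "homogeneous p z a \<subseteq> adjoin K z"
  by (auto simp: homogeneous_def intro: adjoinI)

lemma homogeneous_0: "0 \<in> homogeneous p z a"
proof -
  have "part p a 0 = 0"
    by (intro poly_eqI) (simp add: coeff_part)
  then show ?thesis
    using homogeneous_part[OF polys_over_0, of p a z] by simp
qed

lemma homogeneous_diff:
  assumes "x \<in> homogeneous p z a" "y \<in> homogeneous p z a"
  shows "x - y \<in> homogeneous p z a"
proof -
  obtain f h where "f \<in> polys_over K" "part p a f = f" "x = poly f z"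
    "h \<in> polys_over K" "part p a h = h" "y = poly h z"
    using assms by (auto simp: homogeneous_def)
  then show ?thesis
    unfolding homogeneous_def
    by (auto intro!: exI[of _ "f - h"] simp: polys_over_diff part_diff)
qed

lemma homogeneous_shift:
  assumes "x \<in> homogeneous p z a"
  shows "z ^ k * x \<in> homogeneous p z (k + a)"
proof -
  obtain f where f: "f \<in> polys_over K" "part p a f = f" "x = poly f z"
    using assms by (auto simp: homogeneous_def)
  have "[i = a] (mod p)" if "coeff f i \<noteq> 0" for i
    using that arg_cong[OF f(2), of "\<lambda>f. coeff f i"] by (auto simp: coeff_part split: if_splits)
  then have "[i = k + a] (mod p)" if "coeff (monom 1 k * f) i \<noteq> 0" for i
    using that cong_add_lcancel_nat[of k "i - k" a p] by (auto simp: coeff_monom_mult split: if_splits)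
  then have "part p (k + a) (monom 1 k * f) = monom 1 k * f"
    by (intro poly_eqI) (auto simp: coeff_part)
  moreover have "monom 1 k * f \<in> polys_over K"
    by (intro polys_over_mult polys_over_monom one_mem f)
  ultimately show ?thesis
    unfolding homogeneous_def using f(3) by (auto intro!: exI[of _ "monom 1 k * f"] simp: poly_monom)
qed

lemma homogeneous_smult:
  assumes "c \<in> K" "x \<in> homogeneous p z a"
  shows "c * x \<in> homogeneous p z a"
proof -
  obtain f where f: "f \<in> polys_over K" "part p a f = f" "x = poly f z"
    using assms by (auto simp: homogeneous_def)
  have "part p a (Polynomial.smult c f) = Polynomial.smult c (part p a f)"
    by (intro poly_eqI) (simp add: coeff_part)
  then show ?thesis
    unfolding homogeneous_def using f assms(1)
    by (auto intro!: exI[of _ "Polynomial.smult c f"] simp: polys_over_def mult_mem)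
qed

text \<open>
  The given summands are the homogeneous components of a single relation.
\<close>

lemma homogeneous_independent:
  assumes "graded_relations K p z"
  shows "independent_family p (homogeneous p z)"
  unfolding independent_family_def
proof (intro allI impI)
  fix w a assume w: "\<forall>i<p. w i \<in> homogeneous p z i" "(\<Sum>i<p. w i) = 0" and a: "a < p"
  then have "\<forall>i\<in>{..<p}. \<exists>f. w i = poly f z \<and> f \<in> polys_over K \<and> part p i f = f"
    by (auto simp: homogeneous_def)
  then obtain f where f: "\<And>i. i < p \<Longrightarrow> w i = poly (f i) z \<and> f i \<in> polys_over K \<and> part p i (f i) = f i"
    by (metis bchoice lessThan_iff)
  define F where "F = (\<Sum>i<p. f i)"
  have "F \<in> polys_over K"
    unfolding F_def using f by (intro polys_over_sum) auto
  moreover have "poly F z = 0"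
    using w(2) f by (simp add: F_def poly_sum)
  ultimately have "poly (part p a F) z = 0"
    using assms by (simp add: graded_relations_def)
  moreover have "part p a (f i) = (if i = a then f a else 0)" if "i < p" for i
    using part_part[of p a i "f i"] f[OF that] f[OF a] a that
    by (auto simp: cong_def)
  then have "part p a F = f a"
    using a by (simp add: F_def part_sum)
  ultimately show "w a = 0"
    using f[OF a] by simp
qed

end

context coordinates
begin

lemma coord_zero: "\<phi> \<zero> = 0"
  using add[of "\<zero>" "\<zero>"] by simp

lemma coord_eq_iff: "x \<in> carrier V \<Longrightarrow> y \<in> carrier V \<Longrightarrow> \<phi> x = \<phi> y \<longleftrightarrow> x = y"
  using bij by (auto simp: bij_betw_def inj_on_def)

lemma coord_finsum:
  assumes "finite A" "\<And>i. i \<in> A \<Longrightarrow> u i \<in> carrier V"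
  shows "\<phi> (finsum V u A) = (\<Sum>i\<in>A. \<phi> (u i))"
  using assms
proof (induction A)
  case (insert a A)
  then have "u \<in> A \<rightarrow> carrier V" "u a \<in> carrier V"
    by auto
  then have "finsum V u (insert a A) = u a \<oplus> finsum V u A" "finsum V u A \<in> carrier V"
    using insert by auto
  then show ?case
    using insert add by simp
qed (simp add: coord_zero)

lemma independent_if_direct_sum:
  assumes "direct_sum_decomposition (field_of K) V r U"
  shows "independent_family r (\<lambda>i. \<phi> ` U i)"
  unfolding independent_family_def
proof (intro allI impI)
  fix w a assume w: "\<forall>i<r. w i \<in> \<phi> ` U i" "(\<Sum>i<r. w i) = 0" and a: "a < r"
  have sub: "submodule (field_of K) (U i) V" if "i < r" for i
    using assms that by (simp add: direct_sum_decomposition_def subspace_def)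
  have U: "U i \<subseteq> carrier V" "\<zero> \<in> U i" if "i < r" for i
    using submodule.subset[OF sub[OF that]] submodule.zero_closed[OF sub[OF that]] by auto
  have "\<forall>i\<in>{..<r}. \<exists>x. x \<in> U i \<and> w i = \<phi> x"
    using w(1) by auto
  then obtain u where u: "\<And>i. i < r \<Longrightarrow> u i \<in> U i \<and> w i = \<phi> (u i)"
    by (metis bchoice lessThan_iff)
  define u' where "u' = restrict u {..<r}"
  define o' where "o' = restrict (\<lambda>_. \<zero>) {..<r}"
  have "\<phi> (finsum V u' {..<r}) = 0"
    using coord_finsum[of "{..<r}" u'] u U w(2) by (force simp: u'_def)
  moreover have "finsum V u' {..<r} \<in> carrier V"
    using u U by (intro M.finsum_closed) (force simp: u'_def)
  ultimately have "finsum V u' {..<r} = \<zero>"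
    using coord_eq_iff[of "finsum V u' {..<r}" "\<zero>"] coord_zero by simp
  moreover have "finsum V o' {..<r} = \<zero>"
    by (intro M.add.finprod_one_eqI) (simp add: o'_def)
  moreover have "u' \<in> (\<Pi>\<^sub>E i\<in>{..<r}. U i)" "o' \<in> (\<Pi>\<^sub>E i\<in>{..<r}. U i)"
    using u U by (auto simp: u'_def o'_def)
  moreover have "\<exists>!v. v \<in> (\<Pi>\<^sub>E i\<in>{..<r}. U i) \<and> \<zero> = finsum V v {..<r}"
    using assms M.zero_closed by (simp add: direct_sum_decomposition_def)
  ultimately have "u' = o'"
    by metis
  then have "u' a = o' a"
    by simp
  then have "u a = \<zero>"
    using a by (simp add: u'_def o'_def)
  then show "w a = 0"
    using u[OF a] coord_zero by simp
qed

lemma graded_relations_if_decomposition: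
  assumes D: "direct_sum_decomposition (field_of K) V r U"
    and g: "\<And>x. x \<in> carrier V \<Longrightarrow> \<phi> (g x) = z * \<phi> x"
    and \<pi>: "\<pi> permutes {..<r}" "\<And>i. i < r \<Longrightarrow> g ` U i = U (\<pi> i)"
    and i0: "i0 < r" "U i0 \<noteq> {\<zero>}" "\<pi> i0 \<noteq> i0"
    and z: "z ^ n = 1"
  obtains p where "prime p" "p dvd n" "graded_relations K p z"
proof -
  have sub: "submodule (field_of K) (U i) V" if "i < r" for i
    using D that by (simp add: direct_sum_decomposition_def subspace_def)
  have U: "U i \<subseteq> carrier V" "\<zero> \<in> U i" if "i < r" for i
    using submodule.subset[OF sub[OF that]] submodule.zero_closed[OF sub[OF that]] by auto
  obtain x where x: "x \<in> U i0" "x \<noteq> \<zero>"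
    using U[OF i0(1)] i0(2) by auto
  show thesis
  proof (rule graded_relations_if_blocks[OF independent_if_direct_sum[OF D], of \<pi> z i0 "\<phi> x" n])
    show "0 \<in> \<phi> ` U i" if "i < r" for i
      using U(2)[OF that] coord_zero by (metis image_eqI)
    show "a + b \<in> \<phi> ` U i" if "i < r" "a \<in> \<phi> ` U i" "b \<in> \<phi> ` U i" for i a b
    proof -
      obtain v w where v: "v \<in> U i" "w \<in> U i" "a = \<phi> v" "b = \<phi> w"
        using \<open>a \<in> \<phi> ` U i\<close> \<open>b \<in> \<phi> ` U i\<close> by blast
      have "\<phi> (v \<oplus> w) = a + b"
        using add v U(1)[OF that(1)] by (simp add: subset_iff)
      then show ?thesis
        using submodule.m_closed[OF sub[OF that(1)] v(1,2)] by (metis image_eqI)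
    qed
    show "c * a \<in> \<phi> ` U i" if "i < r" "c \<in> K" "a \<in> \<phi> ` U i" for i c a
    proof -
      obtain v where v: "v \<in> U i" "a = \<phi> v"
        using \<open>a \<in> \<phi> ` U i\<close> by blast
      have "\<phi> (c \<odot> v) = c * a"
        using smult[OF that(2)] v U(1)[OF that(1)] by (simp add: subset_iff)
      moreover have "c \<odot> v \<in> U i"
        using submodule.smult_closed[OF sub[OF that(1)] _ v(1), of c] that(2) by simp
      ultimately show ?thesis
        by (metis image_eqI)
    qed
    show "z * a \<in> \<phi> ` U (\<pi> i)" if "i < r" "a \<in> \<phi> ` U i" for i a
    proof -
      obtain v where v: "v \<in> U i" "a = \<phi> v"
        using \<open>a \<in> \<phi> ` U i\<close> by blast
      have "\<phi> (g v) = z * a"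
        using g v U(1)[OF that(1)] by (simp add: subset_iff)
      moreover have "g v \<in> U (\<pi> i)"
        using \<pi>(2)[OF that(1)] v(1) by blast
      ultimately show ?thesis
        by (metis image_eqI)
    qed
    show "\<phi> x \<in> \<phi> ` U i0"
      using x by blast
    show "\<phi> x \<noteq> 0"
      using x U(1)[OF i0(1)] coord_eq_iff[of x "\<zero>"] coord_zero by auto
  qed (use \<pi>(1) i0 z that in auto)
qed

text \<open>
  The homogeneous components are the blocks: multiplication by \<open>z ^ k\<close> shifts the residue classes by \<open>k\<close>.
\<close>

lemma decomposition_if_graded_relations:
  assumes graded: "graded_relations K p z" and p: "p > 1" "p dvd n" and z: "z ^ n = 1" "n > 0"
  obtains U where "direct_sum_decomposition (field_of K) V p U" "\<forall>i<p. U i \<noteq> carrier V"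
    "\<forall>h k. h ` carrier V \<subseteq> carrier V \<longrightarrow> (\<forall>x\<in>carrier V. \<phi> (h x) = z ^ k * \<phi> x) \<longrightarrow>
      (\<exists>\<pi>. \<pi> permutes {..<p} \<and> (\<forall>i<p. h ` U i = U (\<pi> i)))"
proof -
  define U where "U i = {x \<in> carrier V. \<phi> x \<in> homogeneous p z i}" for i
  have ind: "independent_family p (homogeneous p z)"
    using graded by (rule homogeneous_independent)
  have surj: "\<exists>x\<in>carrier V. \<phi> x = w" if "w \<in> adjoin K z" for w
    using that unfolding bij_betw_imp_surj_on[OF bij, symmetric] by auto
  have hom_neg: "- x \<in> homogeneous p z i" if "x \<in> homogeneous p z i" for i x
    using homogeneous_diff[OF homogeneous_0 that] by simp
  have hom_add: "x + y \<in> homogeneous p z i" if "x \<in> homogeneous p z i" "y \<in> homogeneous p z i" for i x y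
    using homogeneous_diff[OF that(1) hom_neg[OF that(2)]] by simp
  have U_sub: "VectorSpace.subspace (field_of K) (U i) V" for i
    by (intro subspace.intro vectorspace_axioms submodule.intro module_axioms)
      (auto simp: U_def add smult coord_zero homogeneous_0 hom_add homogeneous_smult)
  have ex1: "\<exists>!u. u \<in> (\<Pi>\<^sub>E i\<in>{..<p}. U i) \<and> v = finsum V u {..<p}" if v: "v \<in> carrier V" for v
  proof (rule ex_ex1I)
    have "\<phi> v \<in> adjoin K z"
      using v bij by (auto simp: bij_betw_def)
    then obtain f where f: "f \<in> polys_over K" "\<phi> v = poly f z"
      by (auto simp: adjoin_def)
    have "\<exists>x\<in>carrier V. \<phi> x = poly (part p i f) z" for i
      by (intro surj adjoinI polys_over_part f)
    then obtain u where u: "\<And>i. u i \<in> carrier V" "\<And>i. \<phi> (u i) = poly (part p i f) z"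
      by metis
    define u' where "u' = restrict u {..<p}"
    have u': "u' \<in> (\<Pi>\<^sub>E i\<in>{..<p}. U i)"
      using u f by (auto simp: u'_def U_def homogeneous_part)
    have "\<phi> (finsum V u' {..<p}) = (\<Sum>i<p. poly (part p i f) z)"
      using u by (subst coord_finsum) (auto simp: u'_def)
    also have "\<dots> = \<phi> v"
      using f(2) p sum_parts[of p f] by (simp flip: poly_sum)
    finally have "finsum V u' {..<p} = v"
      using v u by (subst (asm) coord_eq_iff) (auto simp: u'_def intro!: M.finsum_closed)
    with u' show "\<exists>u. u \<in> (\<Pi>\<^sub>E i\<in>{..<p}. U i) \<and> v = finsum V u {..<p}"
      by blast
  next
    fix u u' assume u: "u \<in> (\<Pi>\<^sub>E i\<in>{..<p}. U i) \<and> v = finsum V u {..<p}"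
      and u': "u' \<in> (\<Pi>\<^sub>E i\<in>{..<p}. U i) \<and> v = finsum V u' {..<p}"
    have U: "u i \<in> U i" "u' i \<in> U i" "u i \<in> carrier V" "u' i \<in> carrier V" if "i < p" for i
      using PiE_mem[of u "{..<p}" U i] PiE_mem[of u' "{..<p}" U i] u u' that by (auto simp: U_def)
    have "(\<Sum>i<p. \<phi> (u i)) = (\<Sum>i<p. \<phi> (u' i))"
      using u u' U coord_finsum[of "{..<p}" u] coord_finsum[of "{..<p}" u'] by simp
    then have "(\<Sum>i<p. \<phi> (u i) - \<phi> (u' i)) = 0"
      by (simp add: sum_subtractf)
    moreover have "\<phi> (u i) - \<phi> (u' i) \<in> homogeneous p z i" if "i < p" for i
      using U(1,2)[OF that] by (simp add: U_def homogeneous_diff)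
    ultimately have diff0: "\<phi> (u i) - \<phi> (u' i) = 0" if "i < p" for i
      using independent_familyD[OF ind, of "\<lambda>i. \<phi> (u i) - \<phi> (u' i)" i] that by blast
    have "u i = u' i" if "i < p" for i
      using diff0[OF that] U[OF that] coord_eq_iff[of "u i" "u' i"] by simp
    then show "u = u'"
      using u u' by (intro PiE_ext[of u "{..<p}" U u']) auto
  qed
  show thesis
  proof (rule that; (intro allI impI)?)
    show "direct_sum_decomposition (field_of K) V p U"
      using U_sub ex1 by (simp add: direct_sum_decomposition_def)
  next
    fix i assume i: "i < p"
    show "U i \<noteq> carrier V"
    proof
      assume eq: "U i = carrier V"
      \<comment> \<open>Any residue class other than that of \<open>i\<close> will do.\<close>
      define b where "b = (if i = 0 then 1 else 0 :: nat)"
      have b: "b < p" "b \<noteq> i"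
        using p i by (auto simp: b_def)
      have "1 \<in> homogeneous p z 0"
        using homogeneous_part[OF polys_over_1, of p 0 z] part_monom[of p 0 1 0]
        by (simp add: monom_0 one_pCons)
      then have zb: "z ^ b \<in> homogeneous p z b"
        using homogeneous_shift[of 1 p z 0 b] by simp
      then obtain x where "x \<in> carrier V" "\<phi> x = z ^ b"
        using surj homogeneous_subset by blast
      then have "x \<in> U i"
        using eq by simp
      then have zi: "z ^ b \<in> homogeneous p z i"
        using \<open>\<phi> x = z ^ b\<close> by (simp add: U_def)
      have "z ^ b = 0"
        by (rule independent_family_disjoint[OF ind homogeneous_0 hom_neg zb zi b(1) i b(2)])
      then show False
        using z by (auto simp: power_0_left)
    qed
  next
    fix h k assume h: "h ` carrier V \<subseteq> carrier V"
      and hk: "\<forall>x\<in>carrier V. \<phi> (h x) = z ^ k * \<phi> x"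
    define \<pi> where "\<pi> i = (if i < p then (k + i) mod p else i)" for i
    have "inj_on \<pi> {..<p}"
    proof (rule inj_onI)
      fix i j assume "i \<in> {..<p}" "j \<in> {..<p}" "\<pi> i = \<pi> j"
      then have "[k + i = k + j] (mod p)" "i < p" "j < p"
        by (auto simp: \<pi>_def cong_def)
      then show "i = j"
        unfolding cong_add_lcancel_nat by (simp add: cong_def)
    qed
    moreover have "\<pi> ` {..<p} \<subseteq> {..<p}"
      using p by (auto simp: \<pi>_def)
    ultimately have "bij_betw \<pi> {..<p} {..<p}"
      by (simp add: bij_betw_def endo_inj_surj)
    then have "\<pi> permutes {..<p}"
      by (rule bij_imp_permutes) (simp add: \<pi>_def)
    moreover have "h ` U i = U (\<pi> i)" if i: "i < p" for i
    proof
      have cong: "homogeneous p z (\<pi> i) = homogeneous p z (k + i)"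
        using i by (intro homogeneous_cong) (simp add: \<pi>_def)
      show "h ` U i \<subseteq> U (\<pi> i)"
      proof
        fix y assume "y \<in> h ` U i"
        then obtain x where x: "x \<in> U i" "y = h x"
          by blast
        then have "x \<in> carrier V" "\<phi> x \<in> homogeneous p z i"
          by (simp_all add: U_def)
        then show "y \<in> U (\<pi> i)"
          unfolding U_def cong using h hk homogeneous_shift x(2) by auto
      qed
      show "U (\<pi> i) \<subseteq> h ` U i"
      proof
        fix y assume y: "y \<in> U (\<pi> i)"
        \<comment> \<open>The factor \<open>z ^ ((n - 1) * k)\<close> is the inverse of \<open>z ^ k\<close>, written with a nonnegative exponent.\<close>
        then have "z ^ ((n - 1) * k) * \<phi> y \<in> homogeneous p z ((n - 1) * k + (k + i))"
          by (intro homogeneous_shift) (simp add: U_def cong)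
        moreover have "(n - 1) * k + (k + i) = n * k + i"
          using z(2) by (cases n) simp_all
        moreover have "homogeneous p z (n * k + i) = homogeneous p z i"
        proof (rule homogeneous_cong)
          obtain c where "n = p * c"
            using p(2) by (elim dvdE)
          then show "[n * k + i = i] (mod p)"
            by (simp add: cong_def mult.assoc)
        qed
        ultimately have mem: "z ^ ((n - 1) * k) * \<phi> y \<in> homogeneous p z i"
          by (simp only:)
        then obtain x where x: "x \<in> carrier V" "\<phi> x = z ^ ((n - 1) * k) * \<phi> y"
          using surj homogeneous_subset by blast
        have "k + (n - 1) * k = n * k"
          using z(2) by (cases n) simp_all
        then have "z ^ k * z ^ ((n - 1) * k) = (z ^ n) ^ k"
          by (simp only: power_add[symmetric] power_mult[symmetric])
        then have "z ^ k * z ^ ((n - 1) * k) = 1"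
          using z(1) by simp
        then have "\<phi> (h x) = \<phi> y"
          unfolding hk[rule_format, OF x(1)] x(2) mult.assoc[symmetric] by simp
        moreover have "h x \<in> carrier V" "y \<in> carrier V"
          using x(1) h y by (auto simp: U_def)
        ultimately have "h x = y"
          using coord_eq_iff by blast
        moreover have "x \<in> U i"
          using x mem by (simp add: U_def)
        ultimately show "y \<in> h ` U i"
          by blast
      qed
    qed
    ultimately show "\<exists>\<pi>. \<pi> permutes {..<p} \<and> (\<forall>i<p. h ` U i = U (\<pi> i))"
      by blast
  qed
qed

end

section \<open>Primitivity of irreducible cyclic linear groups\<close>

lemma complex_subfield_if_number_field:
  assumes "number_field K"
  shows "complex_subfield K"
proof
  let ?C = "class_ring :: complex ring"
  have K: "subfield K ?C"
    using assms by (simp add: number_field_def)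
  note ring = subringE[OF subfieldE(1)[OF K]]
  show "1 \<in> K"
    using ring(3) by simp
  show "x * y \<in> K" if "x \<in> K" "y \<in> K" for x y
    using ring(6)[OF that] by simp
  show "x - y \<in> K" if "x \<in> K" "y \<in> K" for x y
    using ring(7)[OF that(1) ring(5)[OF that(2)]] by (simp add: class_ring_simps)
  show "inverse x \<in> K" if "x \<in> K" for x
    using ring.subfield_m_inv(1)[OF class_ring.ring_axioms K, of x] that ring(2)
    by (cases "x = 0") (simp_all add: class_ring_simps)
qed

text \<open>
  The powers of \<open>g\<close> enter as iterated functions and are compared on the carrier only, because
  the elements of \<^const>\<open>GL\<close> are extensional and their product is restricted composition.
\<close>

lemma cyclic_linear_group_generator:
  assumes G: "linear_group F V G" and iso: "(GL F V)\<lparr>carrier := G\<rparr> \<cong> integer_mod_group n" and n: "n > 0"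
  obtains g where "g \<in> G" "g \<in> module_hom F V V"
    "\<forall>h\<in>G. \<exists>k. \<forall>x\<in>carrier V. h x = (g ^^ k) x"
    "\<forall>j. (\<forall>x\<in>carrier V. (g ^^ j) x = x) \<longleftrightarrow> n dvd j"
proof -
  have sub: "subgroup G (GL F V)"
    using G by (simp add: linear_group_def)
  have GL: "h \<in> module_hom F V V" "h \<in> Bij (carrier V)" if "h \<in> G" for h
    using subgroup.subset[OF sub] that by (auto simp: GL_def)
  have mult: "h \<otimes>\<^bsub>GL F V\<^esub> h' = compose (carrier V) h h'" if "h \<in> G" "h' \<in> G" for h h'
    using GL(2) that by (simp add: GL_def BijGroup_def)
  define e where "e = \<one>\<^bsub>GL F V\<^esub>"
  have e: "e = (\<lambda>x\<in>carrier V. x)" "e \<in> G"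
    using subgroup.one_closed[OF sub] by (simp_all add: e_def GL_def BijGroup_def)
  have e_apply: "e x = x" if "x \<in> carrier V" for x
    using that by (simp add: e(1))
  obtain \<psi> where \<psi>: "\<psi> \<in> iso ((GL F V)\<lparr>carrier := G\<rparr>) (integer_mod_group n)"
    using iso by (auto simp: is_iso_def)
  have bij: "bij_betw \<psi> G {0..<int n}"
    using \<psi> n by (simp add: iso_def carrier_integer_mod_group)
  have \<psi>_mult: "\<psi> (compose (carrier V) h h') = (\<psi> h + \<psi> h') mod int n" if "h \<in> G" "h' \<in> G" for h h'
  proof -
    have "\<psi> \<in> hom ((GL F V)\<lparr>carrier := G\<rparr>) (integer_mod_group n)"
      using \<psi> by (simp add: iso_def)
    then have "\<psi> (h \<otimes>\<^bsub>GL F V\<^esub> h') = (\<psi> h + \<psi> h') mod int n"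
      using that by (auto simp: hom_def)
    then show ?thesis
      using mult that by simp
  qed
  have range: "0 \<le> \<psi> h" "\<psi> h < int n" if "h \<in> G" for h
    using bij that by (auto simp: bij_betw_def)
  have inj: "h = h'" if "h \<in> G" "h' \<in> G" "\<psi> h = \<psi> h'" for h h'
    using bij that by (auto simp: bij_betw_def inj_on_def)
  have "compose (carrier V) e e = e"
    by (auto simp: compose_def e)
  then have "\<psi> e = (\<psi> e + \<psi> e) mod int n"
    using \<psi>_mult[OF e(2) e(2)] by simp
  then have "(\<psi> e + \<psi> e) mod int n = \<psi> e mod int n"
    using range[OF e(2)] by (simp add: mod_pos_pos_trivial)
  then have "int n dvd \<psi> e"
    unfolding mod_eq_dvd_iff by simp
  then have \<psi>_e: "\<psi> e = 0"
    using range[OF e(2)] by (simp add: dvd_eq_mod_eq_0)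
  have "1 mod int n \<in> \<psi> ` G"
    using bij_betw_imp_surj_on[OF bij] n by simp
  then obtain g where g: "g \<in> G" "\<psi> g = 1 mod int n"
    by (metis imageE)
  have pow: "\<exists>h\<in>G. \<psi> h = int k mod int n \<and> (\<forall>x\<in>carrier V. h x = (g ^^ k) x)" for k
  proof (induction k)
    case 0
    then show ?case
      using e(2) \<psi>_e e_apply by (intro bexI[of _ e]) simp_all
  next
    case (Suc k)
    then obtain h where h: "h \<in> G" "\<psi> h = int k mod int n" "\<forall>x\<in>carrier V. h x = (g ^^ k) x"
      by blast
    have "compose (carrier V) g h \<in> G"
      using subgroup.m_closed[OF sub g(1) h(1)] mult[OF g(1) h(1)] by simp
    moreover have "\<psi> (compose (carrier V) g h) = int (Suc k) mod int n"
      using \<psi>_mult[OF g(1) h(1)] g h by (simp add: mod_add_eq)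
    moreover have "\<forall>x\<in>carrier V. compose (carrier V) g h x = (g ^^ Suc k) x"
      using h(3) by (simp add: compose_def)
    ultimately show ?case
      by blast
  qed
  have powers: "\<exists>k. \<forall>x\<in>carrier V. h x = (g ^^ k) x" if "h \<in> G" for h
  proof -
    obtain h' where h': "h' \<in> G" "\<psi> h' = int (nat (\<psi> h)) mod int n"
      "\<forall>x\<in>carrier V. h' x = (g ^^ nat (\<psi> h)) x"
      using pow by blast
    have "\<psi> h' = \<psi> h"
      using h'(2) range[OF that] by simp
    then have "h' = h"
      using inj h'(1) that by blast
    then show ?thesis
      using h'(3) by blast
  qed
  have order: "(\<forall>x\<in>carrier V. (g ^^ j) x = x) \<longleftrightarrow> n dvd j" for j
  proof -
    obtain h where h: "h \<in> G" "\<psi> h = int j mod int n" "\<forall>x\<in>carrier V. h x = (g ^^ j) x"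
      using pow by blast
    have "(\<forall>x\<in>carrier V. (g ^^ j) x = x) \<longleftrightarrow> (\<forall>x\<in>carrier V. h x = e x)"
      using h(3) e_apply by simp
    also have "\<dots> \<longleftrightarrow> h = e"
      using extensionalityI[of h "carrier V" e] GL(2)[OF h(1)] GL(2)[OF e(2)] by (auto simp: Bij_def)
    also have "\<dots> \<longleftrightarrow> \<psi> h = 0"
      using inj[OF h(1) e(2)] \<psi>_e by auto
    also have "\<dots> \<longleftrightarrow> n dvd j"
      using h(2) by (simp add: dvd_eq_mod_eq_0[symmetric])
    finally show ?thesis .
  qed
  show thesis
    using that g(1) GL(1)[OF g(1)] powers order by blast
qed

theorem corollary6p2:
  fixes K :: "complex set" and n :: nat
    and V :: "(complex, 'v, 'm) module_scheme" and G :: "('v \<Rightarrow> 'v) set"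
  assumes "number_field K" and "n \<ge> 1"
    and "irreducible_cyclic_linear_group n (field_of K) V G"
  shows "primitive_linear_group (field_of K) V G \<longleftrightarrow>
    supernatural_dvd (supernatural_of_nat n) (hat (kappa K n))"
proof -
  have n: "n > 0"
    using assms(2) by simp
  have irr: "irreducible_linear_group (field_of K) V G"
    and iso: "(GL (field_of K) V)\<lparr>carrier := G\<rparr> \<cong> integer_mod_group n"
    using assms(3) by (simp_all add: irreducible_cyclic_linear_group_def)
  then have lin: "linear_group (field_of K) V G" and nontrivial: "carrier V \<noteq> {\<zero>\<^bsub>V\<^esub>}"
    by (simp_all add: irreducible_linear_group_def)
  interpret complex_subfield K
    using assms(1) by (rule complex_subfield_if_number_field)
  interpret vectorspace "field_of K" V
    using lin by (simp add: linear_group_def)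
  obtain g where g: "g \<in> G" "g \<in> module_hom (field_of K) V V"
    and powers: "\<forall>h\<in>G. \<exists>k. \<forall>x\<in>carrier V. h x = (g ^^ k) x"
    and order: "\<forall>j. (\<forall>x\<in>carrier V. (g ^^ j) x = x) \<longleftrightarrow> n dvd j"
    by (rule cyclic_linear_group_generator[OF lin iso n])
  have invariant: "W = {\<zero>\<^bsub>V\<^esub>} \<or> W = carrier V"
    if W: "VectorSpace.subspace (field_of K) W V" "g ` W \<subseteq> W" for W
  proof -
    have "submodule (field_of K) W V"
      using W(1) by (simp add: subspace_def)
    then have "W \<subseteq> carrier V"
      by (rule submodule.subset)
    have "(g ^^ k) x \<in> W" if "x \<in> W" for k x
      using that W(2) by (induction k) auto
    then have "\<forall>h\<in>G. h ` W \<subseteq> W"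
      using powers \<open>W \<subseteq> carrier V\<close> by (metis image_subsetI subsetD)
    then show ?thesis
      using irr W(1) by (simp add: irreducible_linear_group_def)
  qed
  interpret irreducible_endomorphism K V g
    by unfold_locales (use g invariant in auto)
  obtain \<phi> z where z: "primitive_root_unity n z" and coord: "coordinates K V \<phi> z"
    and \<phi>_g: "\<forall>x\<in>carrier V. \<phi> (g x) = z * \<phi> x"
    by (rule coordinates_exist[OF n order[rule_format] nontrivial])
  interpret coordinates K V \<phi> z
    by (rule coord)
  have zn: "z ^ n = 1"
    using z by (rule primitive_root_unity_power_eq_1)
  have "imprimitive_linear_group (field_of K) V G \<longleftrightarrow>
      (\<exists>p. prime p \<and> p dvd n \<and> graded_relations K p z)"
  proof
    assume "imprimitive_linear_group (field_of K) V G"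
    then obtain r U where D: "direct_sum_decomposition (field_of K) V r U"
      and proper: "\<forall>i<r. U i \<noteq> carrier V"
      and perm: "\<forall>h\<in>G. \<exists>\<pi>. \<pi> permutes {..<r} \<and> (\<forall>i<r. h ` U i = U (\<pi> i))"
      unfolding imprimitive_linear_group_def by blast
    obtain \<pi> where \<pi>: "\<pi> permutes {..<r}" "\<forall>i<r. g ` U i = U (\<pi> i)"
      using bspec[OF perm g(1)] by (elim exE conjE)
    \<comment> \<open>The decomposition may contain zero summands, but a fixed nonzero one would be invariant.\<close>
    have "\<exists>i<r. U i \<noteq> {\<zero>\<^bsub>V\<^esub>}"
    proof (rule ccontr)
      assume zero: "\<not> ?thesis"
      have "v = \<zero>\<^bsub>V\<^esub>" if "v \<in> carrier V" for v
      proof -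
        have "\<exists>!u. u \<in> (\<Pi>\<^sub>E i\<in>{..<r}. U i) \<and> v = finsum V u {..<r}"
          using D that by (simp add: direct_sum_decomposition_def)
        then obtain u where u: "u \<in> (\<Pi>\<^sub>E i\<in>{..<r}. U i)" "v = finsum V u {..<r}"
          by blast
        have "u i = \<zero>\<^bsub>V\<^esub>" if "i \<in> {..<r}" for i
          using PiE_mem[OF u(1) that] zero that by auto
        then show ?thesis
          unfolding u(2) by (rule M.add.finprod_one_eqI)
      qed
      then show False
        using nontrivial M.zero_closed by blast
    qed
    then obtain i0 where i0: "i0 < r" "U i0 \<noteq> {\<zero>\<^bsub>V\<^esub>}"
      by blast
    have moved: "\<pi> i0 \<noteq> i0"
    proof
      assume "\<pi> i0 = i0"
      then have "g ` U i0 \<subseteq> U i0"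
        using \<pi>(2) i0(1) by simp
      then show False
        using invariant[of "U i0"] D i0 proper by (simp add: direct_sum_decomposition_def)
    qed
    obtain p where "prime p" "p dvd n" "graded_relations K p z"
      by (rule graded_relations_if_decomposition[OF D \<phi>_g[rule_format] \<pi>(1) \<pi>(2)[rule_format] i0 moved zn])
    then show "\<exists>p. prime p \<and> p dvd n \<and> graded_relations K p z"
      by blast
  next
    assume "\<exists>p. prime p \<and> p dvd n \<and> graded_relations K p z"
    then obtain p where p: "prime p" "p dvd n" "graded_relations K p z"
      by blast
    obtain U where D: "direct_sum_decomposition (field_of K) V p U"
      and proper: "\<forall>i<p. U i \<noteq> carrier V"
      and perm: "\<forall>h k. h ` carrier V \<subseteq> carrier V \<longrightarrow> (\<forall>x\<in>carrier V. \<phi> (h x) = z ^ k * \<phi> x) \<longrightarrow>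
        (\<exists>\<pi>. \<pi> permutes {..<p} \<and> (\<forall>i<p. h ` U i = U (\<pi> i)))"
      by (rule decomposition_if_graded_relations[OF p(3) prime_gt_1_nat[OF p(1)] p(2) zn n])
    have "\<exists>\<pi>. \<pi> permutes {..<p} \<and> (\<forall>i<p. h ` U i = U (\<pi> i))" if hG: "h \<in> G" for h
    proof -
      obtain k where k: "\<forall>x\<in>carrier V. h x = (g ^^ k) x"
        using bspec[OF powers hG] by (elim exE)
      have pow: "(g ^^ k) x \<in> carrier V \<and> \<phi> ((g ^^ k) x) = z ^ k * \<phi> x" if "x \<in> carrier V" for x k
        using that by (induction k) (simp_all add: g_closed \<phi>_g)
      show ?thesis
      proof (rule perm[rule_format])
        show "h ` carrier V \<subseteq> carrier V"
          using k pow by auto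
        show "\<phi> (h x) = z ^ k * \<phi> x" if "x \<in> carrier V" for x
          using k pow that by simp
      qed
    qed
    then show "imprimitive_linear_group (field_of K) V G"
      unfolding imprimitive_linear_group_def using irr D proper
      by (intro conjI exI[of _ p] exI[of _ U]) simp_all
  qed
  then have "primitive_linear_group (field_of K) V G \<longleftrightarrow>
      (\<forall>p. prime p \<longrightarrow> p dvd n \<longrightarrow> \<not> (p * p dvd n \<and> multiplicity p (kappa K n) < multiplicity p n))"
    using irr graded_relations_iff_kappa[OF complex_subfield_axioms z n]
    by (auto simp: primitive_linear_group_def)
  also have "\<dots> \<longleftrightarrow> supernatural_dvd (supernatural_of_nat n) (hat (kappa K n))"
    using supernatural_dvd_hat_iff[OF n dvd_pos_nat[OF n kappa_dvd[OF n]], of K] dvd_mult_left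
    by blast
  finally show ?thesis .
qed

end
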